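(* Let $k,m$ be nonnegative integers, let $\mathcal K,\mathcal K'$ be Hilbert spaces and let $\Theta:=\sum_{|\alpha|\le m}R_\alpha\otimes\theta_{(\alpha)}$, where $\theta_{(\alpha)}\in B(\mathcal K,\mathcal K')$. Then there exists an operator $\phi\in B(\mathcal K,F^2(H_n)\otimes\mathcal K')$ such that $$\theta_{(\alpha)}=\phi_{(\alpha)}\quad\text{if }|\alpha|\le m,\qquad\text{and}\qquad\|M_\phi\|_{\mathcal P_k}\le1$$ if and only if $$\begin{cases}\|P_{\mathcal P_m\otimes\mathcal K'}\Theta|_{\mathcal P_k\otimes\mathcal K}\|\le1&\text{if }k\le m,\\ \|P_{\mathcal P_m\otimes\mathcal K'}\Theta|_{\mathcal P_m\otimes\mathcal K}\|\le1&\text{if }k>m.\end{cases}$$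
   Context: $H_n$ is an $n$-dimensional complex Hilbert space with orthonormal basis $e_1,\dots,e_n$, where $n\in\{1,2,\dots\}$ or $n=\infty$. The full Fock space is $F^2(H_n)=\bigoplus_{p\ge0}H_n^{\otimes p}$ with $H_n^{\otimes0}=\mathbb C1$; left and right creation operators are $S_i\psi=e_i\otimes\psi$, $R_i\psi=\psi\otimes e_i$. $\mathbb F_n^+$ is the free monoid on generators $g_1,\dots,g_n$ with identity $g_0$; for $\alpha=g_{i_1}\cdots g_{i_p}$, $|\alpha|=p$, $e_\alpha=e_{i_1}\otimes\cdots\otimes e_{i_p}$, the reverse is $\tilde\alpha=g_{i_p}\cdots g_{i_1}$, and $X_\alpha=X_{i_1}\cdots X_{i_p}$ for operators $X_1,\dots,X_n$; $|g_0|=0$, $e_{g_0}=1$, $X_{g_0}=I$. $\mathcal P_k=\bigoplus_{p=0}^kH_n^{\otimes p}$ is the space of polynomials of degree $\le k$ in $F^2(H_n)$; $P_{\mathcal M}$ is the orthogonal projection onto $\mathcal M$. For $\phi\in B(\mathcal K,F^2(H_n)\otimes\mathcal K')$, the coefficients $\phi_{(\alpha)}\in B(\mathcal K,\mathcal K')$ are defined by $\langle\phi_{(\tilde\alpha)}h,h'\rangle=\langle\phi h,e_\alpha\otimes h'\rangle$ for $h\in\mathcal K$, $h'\in\mathcal K'$. $M_\phi$ is the linear map (possibly unbounded, defined on polynomials with coefficients in $\mathcal K$) determined by $M_\phi(1\otimes h)=\phi h$ and $M_\phi(S_i\otimes I_{\mathcal K})=(S_i\otimes I_{\mathcal K'})M_\phi$,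 i.e. $M_\phi(e_\alpha\otimes h)=(S_\alpha\otimes I_{\mathcal K'})\phi h$ (formally $M_\phi\sim\sum_\alpha R_\alpha\otimes\phi_{(\alpha)}$); its restriction to each $\mathcal P_k\otimes\mathcal K$ is bounded, and $\|M_\phi\|_{\mathcal P_k}:=\sup\{\|M_\phi q\|:q\in\mathcal P_k\otimes\mathcal K,\ \|q\|\le1\}$. If $n=\infty$, it is understood that the $\theta_{(\alpha)}$, $|\alpha|\le m$, are such that $h\mapsto\sum_{|\alpha|\le m}e_{\tilde\alpha}\otimes\theta_{(\alpha)}h$ is a bounded operator, so that $\Theta$ is defined (automatic for finite $n$). *)

theory Defs
  imports "HOL-Analysis.Analysis"
begin

section \<open>Complex Hilbert spaces\<close>

text \<open>The inner product is linear in the first argument. The norm is the one inherited from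
  \<^class>\<open>real_inner\<close>, whose inner product is the real part of the complex one.\<close>

class complex_inner = real_inner +
  fixes scaleC :: "complex \<Rightarrow> 'a \<Rightarrow> 'a" (infixr "*\<^sub>C" 75)
    and cinner :: "'a \<Rightarrow> 'a \<Rightarrow> complex"
  assumes scaleC_add_right: "c *\<^sub>C (x + y) = c *\<^sub>C x + c *\<^sub>C y"
    and scaleC_add_left: "(c + d) *\<^sub>C x = c *\<^sub>C x + d *\<^sub>C x"
    and scaleC_scaleC: "c *\<^sub>C (d *\<^sub>C x) = (c * d) *\<^sub>C x"
    and scaleC_of_real: "complex_of_real r *\<^sub>C x = r *\<^sub>R x"
    and cinner_commute: "cinner x y = cnj (cinner y x)"
    and cinner_add_left: "cinner (x + y) z = cinner x z + cinner y z"
    and cinner_scaleC_left: "cinner (c *\<^sub>C x) y = c * cinner x y"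
    and inner_eq_Re_cinner: "inner x y = Re (cinner x y)"

class chilbert = complex_inner + complete_space

instantiation complex :: chilbert
begin
definition scaleC_complex :: "complex \<Rightarrow> complex \<Rightarrow> complex" where "scaleC_complex = (*)"
definition cinner_complex :: "complex \<Rightarrow> complex \<Rightarrow> complex" where "cinner_complex x y = x * cnj y"
instance
  by standard
    (auto simp: scaleC_complex_def cinner_complex_def algebra_simps scaleR_conv_of_real inner_complex_def)
end

lemma scaleC_one [simp]: "1 *\<^sub>C x = (x :: 'a::complex_inner)"
  using scaleC_of_real[of 1 x] by simp

lemma scaleC_zero_left [simp]: "0 *\<^sub>C x = (0 :: 'a::complex_inner)"
  using scaleC_of_real[of 0 x] by simp

lemma scaleC_zero_right [simp]: "c *\<^sub>C 0 = (0 :: 'a::complex_inner)"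
  using scaleC_add_right[of c "0::'a" 0] by simp

lemma cinner_zero_left [simp]: "cinner 0 (y :: 'a::complex_inner) = 0"
  using cinner_add_left[of "0::'a" 0 y] by simp

lemma cinner_scaleC_right: "cinner x (c *\<^sub>C y) = cnj c * cinner x (y :: 'a::complex_inner)"
  by (metis cinner_commute cinner_scaleC_left complex_cnj_mult)

lemma cinner_zero_right [simp]: "cinner (x :: 'a::complex_inner) 0 = 0"
  by (metis cinner_commute cinner_zero_left complex_cnj_zero)

lemma cinner_self: "cinner x x = complex_of_real ((norm (x :: 'a::complex_inner))\<^sup>2)"
proof (rule complex_eqI)
  show "Re (cinner x x) = Re (complex_of_real ((norm x)\<^sup>2))"
    by (simp add: power2_norm_eq_inner inner_eq_Re_cinner)
  show "Im (cinner x x) = Im (complex_of_real ((norm x)\<^sup>2))"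
    using arg_cong[OF cinner_commute[of x x], of Im] by simp
qed

lemma cinner_diff_left: "cinner (x - y) z = cinner x z - cinner y (z :: 'a::complex_inner)"
  by (metis add_diff_cancel cinner_add_left diff_add_cancel)

lemma Im_cinner: "Im (cinner x y) = inner x (\<i> *\<^sub>C (y :: 'a::complex_inner))"
  by (simp add: inner_eq_Re_cinner cinner_scaleC_right)

lemma norm_scaleC: "norm (c *\<^sub>C x) = cmod c * norm (x :: 'a::complex_inner)"
proof -
  have "complex_of_real ((norm (c *\<^sub>C x))\<^sup>2) = (c * cnj c) * complex_of_real ((norm x)\<^sup>2)"
    by (simp add: cinner_scaleC_left cinner_scaleC_right mult.assoc del: of_real_power flip: cinner_self)
  also have "\<dots> = complex_of_real ((cmod c * norm x)\<^sup>2)"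
    by (simp add: power_mult_distrib flip: complex_norm_square)
  finally have "(norm (c *\<^sub>C x))\<^sup>2 = (cmod c * norm x)\<^sup>2"
    using of_real_eq_iff by blast
  then show ?thesis by simp
qed

lemma cinner_extensionality:
  assumes "\<And>z. cinner x z = cinner y (z :: 'a::complex_inner)" shows "x = y"
proof -
  have "cinner (x - y) (x - y) = 0"
    using assms[of "x - y"] by (simp add: cinner_diff_left)
  then show ?thesis by (simp add: cinner_self)
qed

definition bounded_clinear :: "('a::complex_inner \<Rightarrow> 'b::complex_inner) \<Rightarrow> bool" where
  "bounded_clinear T \<longleftrightarrow> bounded_linear T \<and> (\<forall>c x. T (c *\<^sub>C x) = c *\<^sub>C T x)"

definition orth_proj :: "'a::complex_inner set \<Rightarrow> 'a \<Rightarrow> 'a" where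
  "orth_proj V x = (THE y. y \<in> V \<and> (\<forall>z\<in>V. cinner (x - y) z = 0))"

text \<open>The norm of the restriction of \<^term>\<open>T\<close> to the subspace \<^term>\<open>V\<close>; it is taken in
  \<^typ>\<open>ennreal\<close>, so that an unbounded restriction has norm \<^term>\<open>\<infinity> :: ennreal\<close>.\<close>

definition norm_on :: "'a::real_normed_vector set \<Rightarrow> ('a \<Rightarrow> 'b::real_normed_vector) \<Rightarrow> ennreal" where
  "norm_on V T = (SUP q \<in> {q \<in> V. norm q \<le> 1}. ennreal (norm (T q)))"


section \<open>Hilbert-space valued square-summable families\<close>

typedef (overloaded) ('w, 'a::real_inner) ell2 =
  "{f :: 'w \<Rightarrow> 'a. (\<lambda>w. (norm (f w))\<^sup>2) summable_on UNIV}"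
  morphisms component Abs_ell2
  by (rule exI[of _ "\<lambda>_. 0"]) simp

setup_lifting type_definition_ell2

lemma ell2_eqI: "(\<And>w. component f w = component g w) \<Longrightarrow> f = g"
  by (metis component_inject ext)

lemma component_summable: "(\<lambda>w. (norm (component f w))\<^sup>2) summable_on A"
  using component[of f] by (auto intro: summable_on_subset_banach)

lemma summable_on_le:
  fixes f g :: "'w \<Rightarrow> real"
  assumes "g summable_on A" "\<And>w. w \<in> A \<Longrightarrow> \<bar>f w\<bar> \<le> g w"
  shows "f summable_on A"
proof -
  have "(\<lambda>w. norm (f w)) summable_on A"
  proof (rule Infinite_Sum.abs_summable_on_comparison_test)
    show "(\<lambda>w. norm (g w)) summable_on A"
      using assms(1) by (rule summable_on_iff_abs_summable_on_real[THEN iffD1])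
    show "norm (f w) \<le> norm (g w)" if "w \<in> A" for w
      using assms(2)[OF that] by simp
  qed
  then show ?thesis by (rule Infinite_Sum.abs_summable_summable)
qed

lemma norm_add_sq_le: "(norm (a + b))\<^sup>2 \<le> 2 * (norm a)\<^sup>2 + 2 * (norm (b :: 'a::real_normed_vector))\<^sup>2"
proof -
  have "(norm (a + b))\<^sup>2 \<le> (norm a + norm b)\<^sup>2"
    by (intro power_mono norm_triangle_ineq) simp
  moreover have "0 \<le> (norm a - norm b)\<^sup>2" by simp
  ultimately show ?thesis by (simp add: power2_sum power2_diff)
qed

lemma ell2_add_summable:
  assumes "(\<lambda>w. (norm (f w))\<^sup>2) summable_on A" "(\<lambda>w. (norm (g w :: 'a::real_normed_vector))\<^sup>2) summable_on A"
  shows "(\<lambda>w. (norm (f w + g w))\<^sup>2) summable_on A"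
proof (rule summable_on_le)
  show "(\<lambda>w. 2 * (norm (f w))\<^sup>2 + 2 * (norm (g w))\<^sup>2) summable_on A"
    by (intro summable_on_add summable_on_cmult_right assms)
  show "\<bar>(norm (f w + g w))\<^sup>2\<bar> \<le> 2 * (norm (f w))\<^sup>2 + 2 * (norm (g w))\<^sup>2" for w
    using norm_add_sq_le[of "f w" "g w"] by simp
qed

lemma inner_summable:
  "(\<lambda>w. inner (component f w) (component g w)) summable_on A"
proof (rule summable_on_le[where g = "\<lambda>w. (norm (component f w))\<^sup>2 + (norm (component g w))\<^sup>2"])
  show "(\<lambda>w. (norm (component f w))\<^sup>2 + (norm (component g w))\<^sup>2) summable_on A"
    by (intro summable_on_add component_summable)
  fix w
  let ?a = "component f w" and ?b = "component g w"
  have "\<bar>inner ?a ?b\<bar> \<le> norm ?a * norm ?b" by (rule Cauchy_Schwarz_ineq2)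
  moreover have "0 \<le> (norm ?a - norm ?b)\<^sup>2" by simp
  then have "2 * (norm ?a * norm ?b) \<le> (norm ?a)\<^sup>2 + (norm ?b)\<^sup>2" by (simp add: power2_diff)
  moreover have "0 \<le> norm ?a * norm ?b" by simp
  ultimately show "\<bar>inner ?a ?b\<bar> \<le> (norm ?a)\<^sup>2 + (norm ?b)\<^sup>2" by linarith
qed

instantiation ell2 :: (type, real_inner) real_vector
begin
lift_definition zero_ell2 :: "('a, 'b) ell2" is "\<lambda>_. 0" by simp
lift_definition plus_ell2 :: "('a, 'b) ell2 \<Rightarrow> ('a, 'b) ell2 \<Rightarrow> ('a, 'b) ell2" is "\<lambda>f g w. f w + g w"
  by (rule ell2_add_summable)
lift_definition uminus_ell2 :: "('a, 'b) ell2 \<Rightarrow> ('a, 'b) ell2" is "\<lambda>f w. - f w" by simp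
lift_definition minus_ell2 :: "('a, 'b) ell2 \<Rightarrow> ('a, 'b) ell2 \<Rightarrow> ('a, 'b) ell2" is "\<lambda>f g w. f w - g w"
proof -
  fix f g :: "'a \<Rightarrow> 'b"
  assume "(\<lambda>w. (norm (f w))\<^sup>2) summable_on UNIV" "(\<lambda>w. (norm (g w))\<^sup>2) summable_on UNIV"
  then show "(\<lambda>w. (norm (f w - g w))\<^sup>2) summable_on UNIV"
    using ell2_add_summable[of f UNIV "\<lambda>w. - g w"] by simp
qed
lift_definition scaleR_ell2 :: "real \<Rightarrow> ('a, 'b) ell2 \<Rightarrow> ('a, 'b) ell2" is "\<lambda>r f w. r *\<^sub>R f w"
  by (simp add: power_mult_distrib summable_on_cmult_right)
instance
  by standard
    (rule ell2_eqI, simp add: zero_ell2.rep_eq plus_ell2.rep_eq uminus_ell2.rep_eq minus_ell2.rep_eq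
      scaleR_ell2.rep_eq algebra_simps)+
end

lemmas component_simps [simp] =
  zero_ell2.rep_eq plus_ell2.rep_eq uminus_ell2.rep_eq minus_ell2.rep_eq scaleR_ell2.rep_eq

instantiation ell2 :: (type, real_inner) real_inner
begin
definition inner_ell2 :: "('a, 'b) ell2 \<Rightarrow> ('a, 'b) ell2 \<Rightarrow> real"
  where "inner_ell2 f g = (\<Sum>\<^sub>\<infinity>w. inner (component f w) (component g w))"
definition norm_ell2 :: "('a, 'b) ell2 \<Rightarrow> real" where "norm_ell2 f = sqrt (inner f f)"
definition dist_ell2 :: "('a, 'b) ell2 \<Rightarrow> ('a, 'b) ell2 \<Rightarrow> real" where "dist_ell2 f g = norm (f - g)"
definition sgn_ell2 :: "('a, 'b) ell2 \<Rightarrow> ('a, 'b) ell2" where "sgn_ell2 f = inverse (norm f) *\<^sub>R f"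
definition uniformity_ell2 :: "(('a, 'b) ell2 \<times> ('a, 'b) ell2) filter"
  where "uniformity_ell2 = (INF e\<in>{0<..}. principal {(x, y). dist x y < e})"
definition open_ell2 :: "('a, 'b) ell2 set \<Rightarrow> bool"
  where "open_ell2 U \<longleftrightarrow> (\<forall>x\<in>U. eventually (\<lambda>(x', y). x' = x \<longrightarrow> y \<in> U) uniformity)"
instance
proof
  fix x y z :: "('a, 'b) ell2" and r :: real
  show "inner x y = inner y x"
    by (simp add: inner_ell2_def inner_commute)
  show "inner (x + y) z = inner x z + inner y z"
    by (simp add: inner_ell2_def inner_add_left infsum_add inner_summable)
  show "inner (r *\<^sub>R x) y = r * inner x y"
    by (simp add: inner_ell2_def infsum_cmult_right inner_summable)
  show "0 \<le> inner x x"
    by (simp add: inner_ell2_def infsum_nonneg)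
  show "inner x x = 0 \<longleftrightarrow> x = 0"
  proof
    assume *: "inner x x = 0"
    show "x = 0"
    proof (rule ell2_eqI)
      fix w
      have "inner (component x w) (component x w) = 0"
        by (rule nonneg_infsum_le_0D[where A = UNIV and f = "\<lambda>w. inner (component x w) (component x w)"])
          (use * in \<open>auto simp: inner_ell2_def inner_summable\<close>)
      then show "component x w = component 0 w" by simp
    qed
  qed (simp add: inner_ell2_def)
qed (simp_all add: norm_ell2_def dist_ell2_def sgn_ell2_def uniformity_ell2_def open_ell2_def)
end

lemma norm_ell2_sq: "(norm f)\<^sup>2 = (\<Sum>\<^sub>\<infinity>w. (norm (component f w))\<^sup>2)"
  by (simp add: power2_norm_eq_inner inner_ell2_def)

lemma sum_component_le: "finite F \<Longrightarrow> (\<Sum>w\<in>F. (norm (component f w))\<^sup>2) \<le> (norm f)\<^sup>2"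
  unfolding norm_ell2_sq by (rule finite_sum_le_infsum) (auto intro: component_summable)

lemma norm_component_le: "norm (component f w) \<le> norm f"
  using sum_component_le[of "{w}" f] by simp

lemma cinner_summable:
  fixes f g :: "('w, 'a::complex_inner) ell2"
  shows "(\<lambda>w. cinner (component f w) (component g w)) summable_on A"
proof -
  have "(\<lambda>w. norm (component g w)^2) summable_on A" by (rule component_summable)
  then have *: "(\<lambda>w. (norm (\<i> *\<^sub>C component g w))\<^sup>2) summable_on UNIV"
    by (simp add: norm_scaleC component_summable)
  define g' where "g' = Abs_ell2 (\<lambda>w. \<i> *\<^sub>C component g w)"
  have g': "component g' w = \<i> *\<^sub>C component g w" for w
    unfolding g'_def by (subst Abs_ell2_inverse) (use * in auto)
  have "(\<lambda>w. complex_of_real (Re (cinner (component f w) (component g w)))) summable_on A"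
    using inner_summable[of f g A] by (intro summable_on_of_real) (simp add: inner_eq_Re_cinner)
  moreover have "(\<lambda>w. \<i> * complex_of_real (Im (cinner (component f w) (component g w)))) summable_on A"
    using inner_summable[of f g' A]
    by (intro summable_on_cmult_right summable_on_of_real) (simp add: g' Im_cinner)
  ultimately have "(\<lambda>w. complex_of_real (Re (cinner (component f w) (component g w)))
      + \<i> * complex_of_real (Im (cinner (component f w) (component g w)))) summable_on A"
    by (rule summable_on_add)
  then show ?thesis by (simp flip: complex_eq)
qed

instantiation ell2 :: (type, complex_inner) complex_inner
begin
lift_definition scaleC_ell2 :: "complex \<Rightarrow> ('a, 'b) ell2 \<Rightarrow> ('a, 'b) ell2" is "\<lambda>c f w. c *\<^sub>C f w"
  by (simp add: norm_scaleC power_mult_distrib summable_on_cmult_right)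
definition cinner_ell2 :: "('a, 'b) ell2 \<Rightarrow> ('a, 'b) ell2 \<Rightarrow> complex"
  where "cinner_ell2 f g = (\<Sum>\<^sub>\<infinity>w. cinner (component f w) (component g w))"
instance
proof
  fix x y z :: "('a, 'b) ell2" and c d :: complex and r :: real
  show "c *\<^sub>C (x + y) = c *\<^sub>C x + c *\<^sub>C y" by transfer (simp add: scaleC_add_right)
  show "(c + d) *\<^sub>C x = c *\<^sub>C x + d *\<^sub>C x" by transfer (simp add: scaleC_add_left)
  show "c *\<^sub>C (d *\<^sub>C x) = (c * d) *\<^sub>C x" by transfer (simp add: scaleC_scaleC)
  show "complex_of_real r *\<^sub>C x = r *\<^sub>R x" by transfer (simp add: scaleC_of_real)
  show "cinner x y = cnj (cinner y x)"
    unfolding cinner_ell2_def infsum_cnj[symmetric] by (rule infsum_cong) (rule cinner_commute)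
  show "cinner (x + y) z = cinner x z + cinner y z"
    by (simp add: cinner_ell2_def cinner_add_left infsum_add cinner_summable)
  show "cinner (c *\<^sub>C x) y = c * cinner x y"
    by (simp add: cinner_ell2_def scaleC_ell2.rep_eq cinner_scaleC_left infsum_cmult_right cinner_summable)
  show "inner x y = Re (cinner x y)"
    unfolding cinner_ell2_def inner_ell2_def inner_eq_Re_cinner
    by (rule infsum_Re[OF cinner_summable])
qed
end

lemmas [simp] = scaleC_ell2.rep_eq

instance ell2 :: (type, chilbert) chilbert
proof
  fix X :: "nat \<Rightarrow> ('a, 'b) ell2"
  assume "Cauchy X"
  then have C: "\<exists>N. \<forall>m\<ge>N. \<forall>n\<ge>N. norm (X m - X n) < e" if "e > 0" for e
    using that by (auto simp: Cauchy_def dist_norm)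
  have "Cauchy (\<lambda>n. component (X n) w)" for w
  proof (rule CauchyI)
    fix e :: real assume "0 < e"
    then obtain N where "\<forall>m\<ge>N. \<forall>n\<ge>N. norm (X m - X n) < e" using C by blast
    moreover have "norm (component (X m) w - component (X n) w) \<le> norm (X m - X n)" for m n
      using norm_component_le[of "X m - X n" w] by simp
    ultimately show "\<exists>N. \<forall>m\<ge>N. \<forall>n\<ge>N. norm (component (X m) w - component (X n) w) < e"
      by (meson le_less_trans)
  qed
  then obtain g where g: "(\<lambda>n. component (X n) w) \<longlonglongrightarrow> g w" for w
    unfolding Cauchy_convergent_iff convergent_def by metis
  have bound: "(\<Sum>w\<in>F. (norm (component (X m) w - g w))\<^sup>2) \<le> e\<^sup>2"
    if N: "\<forall>m\<ge>N. \<forall>n\<ge>N. norm (X m - X n) < e" and "m \<ge> N" "finite F" for e N m F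
  proof (rule LIMSEQ_le_const2)
    show "(\<lambda>n. \<Sum>w\<in>F. (norm (component (X m) w - component (X n) w))\<^sup>2)
        \<longlonglongrightarrow> (\<Sum>w\<in>F. (norm (component (X m) w - g w))\<^sup>2)"
      by (intro tendsto_intros g)
    have "(\<Sum>w\<in>F. (norm (component (X m) w - component (X n) w))\<^sup>2) \<le> e\<^sup>2" if "n \<ge> N" for n
    proof -
      have "(\<Sum>w\<in>F. (norm (component (X m) w - component (X n) w))\<^sup>2) \<le> (norm (X m - X n))\<^sup>2"
        using sum_component_le[OF \<open>finite F\<close>, of "X m - X n"] by simp
      also have "\<dots> \<le> e\<^sup>2"
        using N that \<open>m \<ge> N\<close> by (intro power_mono) (auto intro: less_imp_le)
      finally show ?thesis .
    qed
    then show "\<exists>N. \<forall>n\<ge>N. (\<Sum>w\<in>F. (norm (component (X m) w - component (X n) w))\<^sup>2) \<le> e\<^sup>2" by blast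
  qed
  have sq: "(\<lambda>w. (norm (component (X m) w - g w))\<^sup>2) summable_on UNIV"
      "(\<Sum>\<^sub>\<infinity>w. (norm (component (X m) w - g w))\<^sup>2) \<le> e\<^sup>2"
    if N: "\<forall>m\<ge>N. \<forall>n\<ge>N. norm (X m - X n) < e" and "m \<ge> N" for e N m
  proof -
    show 1: "(\<lambda>w. (norm (component (X m) w - g w))\<^sup>2) summable_on UNIV"
      by (rule nonneg_bdd_above_summable_on)
        (use bound[OF that] in \<open>auto intro!: bdd_aboveI2[where M = "e\<^sup>2"]\<close>)
    show "(\<Sum>\<^sub>\<infinity>w. (norm (component (X m) w - g w))\<^sup>2) \<le> e\<^sup>2"
      by (rule infsum_le_finite_sums[OF 1]) (use bound[OF that] in auto)
  qed
  obtain N where N: "\<forall>m\<ge>N. \<forall>n\<ge>N. norm (X m - X n) < 1" using C[of 1] by auto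
  have "(\<lambda>w. (norm (- (component (X N) w - g w)))\<^sup>2) summable_on UNIV"
    using sq(1)[OF N order_refl] by (simp only: norm_minus_cancel)
  then have "(\<lambda>w. (norm (component (X N) w + - (component (X N) w - g w)))\<^sup>2) summable_on UNIV"
    by (intro ell2_add_summable component_summable)
  then have "(\<lambda>w. (norm (g w))\<^sup>2) summable_on UNIV" by simp
  then obtain G where G: "component G = g"
    using Abs_ell2_inverse[of g] by blast
  have "X \<longlonglongrightarrow> G"
  proof (rule LIMSEQ_I)
    fix r :: real assume "0 < r"
    then obtain N where N: "\<forall>m\<ge>N. \<forall>n\<ge>N. norm (X m - X n) < r/2" using C[of "r/2"] by auto
    have "norm (X m - G) < r" if "m \<ge> N" for m
    proof -
      have "(norm (X m - G))\<^sup>2 \<le> (r/2)\<^sup>2"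
        using sq(2)[OF N that] by (simp only: norm_ell2_sq G minus_ell2.rep_eq)
      moreover have "0 \<le> r/2" using \<open>0 < r\<close> by simp
      ultimately have "norm (X m - G) \<le> r/2"
        by (rule power2_le_imp_le)
      then show ?thesis using \<open>0 < r\<close> by linarith
    qed
    then show "\<exists>N. \<forall>m\<ge>N. norm (X m - G) < r" by blast
  qed
  then show "convergent X" by (auto simp: convergent_def)
qed


section \<open>The full Fock space\<close>

text \<open>Words \<^term>\<open>\<alpha> :: 'i list\<close> are the elements of the free monoid on the generators indexed
  by \<^typ>\<open>'i\<close>, so a countable index type has $n$ elements with $n \in \{1,2,\dots\}$ or $n = \infty$.
  As the $e_\alpha$ form an orthonormal basis of the full Fock space $F^2(H_n)$, the space
  $F^2(H_n) \otimes K$ is the space of square-summable $K$-valued families indexed by words, a family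
  $f$ standing for $\sum_\alpha e_\alpha \otimes f_\alpha$. The words of length $p$ span
  $H_n^{\otimes p} \otimes K$, and $F^2(H_n)$ itself is the case where $K$ is the scalar field.
  The vector $e_\alpha$ is \<open>basis_vec \<alpha>\<close>. The lemmas \<open>cinner_tens\<close> and \<open>has_sum_tens\<close> below say that this is the Hilbert space tensor
  product.\<close>

type_synonym ('i, 'a) fock_tensor = "('i list, 'a) ell2"
type_synonym 'i fock = "('i, complex) fock_tensor"

lift_definition tens :: "('w, complex) ell2 \<Rightarrow> 'a::complex_inner \<Rightarrow> ('w, 'a) ell2" (infixr "\<otimes>" 70)
  is "\<lambda>f h w. f w *\<^sub>C h"
  by (simp add: norm_scaleC power_mult_distrib summable_on_cmult_left)

lift_definition basis_vec :: "'w \<Rightarrow> ('w, complex) ell2" is "\<lambda>v w. if w = v then 1 else 0"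
proof -
  fix v :: 'w
  show "(\<lambda>w. (cmod (if w = v then 1 else 0))\<^sup>2) summable_on UNIV"
    by (subst summable_on_cong_neutral[where T = "{v}" and g = "\<lambda>_. 1"]) auto
qed

lemma component_basis_tens: "component (basis_vec v \<otimes> h) w = (if w = v then h else 0)"
  by (simp add: tens.rep_eq basis_vec.rep_eq)

lemma cinner_tens: "cinner (f \<otimes> h) (g \<otimes> k) = cinner f g * cinner h k"
proof -
  have "cinner (f \<otimes> h) (g \<otimes> k) = (\<Sum>\<^sub>\<infinity>w. cinner (component f w) (component g w) * cinner h k)"
    by (simp add: cinner_ell2_def tens.rep_eq cinner_scaleC_left cinner_scaleC_right cinner_complex_def
        mult_ac)
  then show ?thesis by (simp only: cinner_ell2_def infsum_cmult_left')
qed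

lemma cinner_basis_tens: "cinner f (basis_vec v \<otimes> h) = cinner (component f v) h"
proof -
  have "cinner f (basis_vec v \<otimes> h) = (\<Sum>\<^sub>\<infinity>w\<in>{v}. cinner (component f w) h)"
    unfolding cinner_ell2_def by (rule infsum_cong_neutral) (auto simp: component_basis_tens)
  then show ?thesis by simp
qed

lemma component_sum: "component (sum f A) w = (\<Sum>a\<in>A. component (f a) w)"
  by (induction A rule: infinite_finite_induct) auto

lemma has_sum_tens: "((\<lambda>w. basis_vec w \<otimes> component f w) has_sum f) UNIV"
  unfolding has_sum_def tendsto_iff eventually_finite_subsets_at_top
proof (intro allI impI)
  fix e :: real assume "0 < e"
  let ?n = "\<lambda>w. (norm (component f w))\<^sup>2"
  have "(?n has_sum (norm f)\<^sup>2) UNIV"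
    unfolding norm_ell2_sq by (rule has_sum_infsum[OF component_summable])
  then have "eventually (\<lambda>G. dist (sum ?n G) ((norm f)\<^sup>2) < e\<^sup>2) (finite_subsets_at_top UNIV)"
    unfolding has_sum_def using \<open>0 < e\<close> by (intro tendstoD) simp_all
  then obtain F where F: "finite F"
    and F0: "\<forall>G. finite G \<and> F \<subseteq> G \<and> G \<subseteq> UNIV \<longrightarrow> dist (sum ?n G) ((norm f)\<^sup>2) < e\<^sup>2"
    unfolding eventually_finite_subsets_at_top by (elim exE conjE)
  have F': "dist (sum ?n G) ((norm f)\<^sup>2) < e\<^sup>2" if "finite G" "F \<subseteq> G" for G
    using F0 that by simp
  have "dist (\<Sum>w\<in>G. basis_vec w \<otimes> component f w) f < e" if "finite G" "F \<subseteq> G" for G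
  proof -
    let ?s = "\<Sum>w\<in>G. basis_vec w \<otimes> component f w"
    have s: "component ?s w = (if w \<in> G then component f w else 0)" for w
      using that by (simp add: component_sum component_basis_tens)
    have "(norm f)\<^sup>2 = infsum ?n G + infsum ?n (- G)"
      unfolding norm_ell2_sq
      using infsum_Un_disjoint[of ?n G "- G"] by (simp add: component_summable Compl_partition)
    moreover have "infsum ?n (- G) = (norm (?s - f))\<^sup>2"
      unfolding norm_ell2_sq by (rule infsum_cong_neutral) (auto simp: s)
    ultimately have "(norm (?s - f))\<^sup>2 < e\<^sup>2"
      using F'[OF that] infsum_finite[OF that(1), of ?n] by (simp only: dist_real_def)
    then have "norm (?s - f) < e"
      using less_imp_le[OF \<open>0 < e\<close>] by (rule power2_less_imp_less)
    then show ?thesis by (simp add: dist_norm)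
  qed
  then show "\<exists>F. finite F \<and> F \<subseteq> UNIV \<and> (\<forall>G. finite G \<and> F \<subseteq> G \<and> G \<subseteq> UNIV \<longrightarrow>
      dist (\<Sum>w\<in>G. basis_vec w \<otimes> component f w) f < e)"
    by (intro exI[of _ F]) (simp add: F)
qed

text \<open>$S_i \otimes I_K$ and $R_i \otimes I_K$; for scalar $K$ these are the creation operators $S_i$ and $R_i$
  on the Fock space itself.\<close>

lift_definition left_creation :: "'i \<Rightarrow> ('i, 'a::real_inner) fock_tensor \<Rightarrow> ('i, 'a) fock_tensor"
  is "\<lambda>i f \<gamma>. if \<gamma> \<noteq> [] \<and> hd \<gamma> = i then f (tl \<gamma>) else 0"
proof -
  fix i :: 'i and f :: "'i list \<Rightarrow> 'a"
  let ?c = "Cons i"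
  let ?t = "\<lambda>\<gamma>. (norm (f (tl \<gamma>)))\<^sup>2"
  assume "(\<lambda>\<gamma>. (norm (f \<gamma>))\<^sup>2) summable_on UNIV"
  then have "(?t \<circ> ?c) summable_on UNIV" by (simp add: o_def)
  moreover have "inj ?c" by (simp add: inj_on_def)
  ultimately have "?t summable_on range ?c" by (simp only: summable_on_reindex)
  moreover have "\<gamma> \<in> range ?c" if "\<gamma> \<noteq> []" "hd \<gamma> = i" for \<gamma>
    using that by (cases \<gamma>) auto
  then have "?t summable_on range ?c \<longleftrightarrow>
      (\<lambda>\<gamma>. (norm (if \<gamma> \<noteq> [] \<and> hd \<gamma> = i then f (tl \<gamma>) else 0))\<^sup>2) summable_on UNIV"
    by (intro summable_on_cong_neutral) auto
  ultimately show "(\<lambda>\<gamma>. (norm (if \<gamma> \<noteq> [] \<and> hd \<gamma> = i then f (tl \<gamma>) else 0))\<^sup>2) summable_on UNIV"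
    by blast
qed

lift_definition right_creation :: "'i \<Rightarrow> ('i, 'a::real_inner) fock_tensor \<Rightarrow> ('i, 'a) fock_tensor"
  is "\<lambda>i f \<gamma>. if \<gamma> \<noteq> [] \<and> last \<gamma> = i then f (butlast \<gamma>) else 0"
proof -
  fix i :: 'i and f :: "'i list \<Rightarrow> 'a"
  let ?c = "\<lambda>\<beta>. \<beta> @ [i]"
  let ?t = "\<lambda>\<gamma>. (norm (f (butlast \<gamma>)))\<^sup>2"
  assume "(\<lambda>\<gamma>. (norm (f \<gamma>))\<^sup>2) summable_on UNIV"
  then have "(?t \<circ> ?c) summable_on UNIV" by (simp add: o_def)
  moreover have "inj ?c" by (simp add: inj_on_def)
  ultimately have "?t summable_on range ?c" by (simp only: summable_on_reindex)
  moreover have "\<gamma> \<in> range ?c" if "\<gamma> \<noteq> []" "last \<gamma> = i" for \<gamma>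
    using that by (cases \<gamma> rule: rev_cases) auto
  then have "?t summable_on range ?c \<longleftrightarrow>
      (\<lambda>\<gamma>. (norm (if \<gamma> \<noteq> [] \<and> last \<gamma> = i then f (butlast \<gamma>) else 0))\<^sup>2) summable_on UNIV"
    by (intro summable_on_cong_neutral) auto
  ultimately show "(\<lambda>\<gamma>. (norm (if \<gamma> \<noteq> [] \<and> last \<gamma> = i then f (butlast \<gamma>) else 0))\<^sup>2) summable_on UNIV"
    by blast
qed

lemma left_creation_tens: "left_creation i (f \<otimes> h) = left_creation i f \<otimes> h"
  by (rule ell2_eqI) (simp add: left_creation.rep_eq tens.rep_eq)

lemma right_creation_tens: "right_creation i (f \<otimes> h) = right_creation i f \<otimes> h"
  by (rule ell2_eqI) (simp add: right_creation.rep_eq tens.rep_eq)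

lemma left_creation_basis: "left_creation i (basis_vec \<beta>) = basis_vec (i # \<beta>)"
  by (rule ell2_eqI) (auto simp: left_creation.rep_eq basis_vec.rep_eq)

lemma right_creation_basis: "right_creation i (basis_vec \<beta>) = basis_vec (\<beta> @ [i])"
  by (rule ell2_eqI) (auto simp: right_creation.rep_eq basis_vec.rep_eq)

text \<open>$X_\alpha = X_{i_1} \cdots X_{i_p}$\<close>

fun word_op :: "('i \<Rightarrow> 'x \<Rightarrow> 'x) \<Rightarrow> 'i list \<Rightarrow> 'x \<Rightarrow> 'x" where
  "word_op X [] = id"
| "word_op X (i # \<alpha>) = X i \<circ> word_op X \<alpha>"

lemma word_op_left_creation: "word_op left_creation \<alpha> (basis_vec \<beta> \<otimes> h) = basis_vec (\<alpha> @ \<beta>) \<otimes> h"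
  by (induction \<alpha>) (simp_all add: left_creation_tens left_creation_basis)

lemma word_op_right_creation: "word_op right_creation \<alpha> (basis_vec \<beta> \<otimes> h) = basis_vec (\<beta> @ rev \<alpha>) \<otimes> h"
  by (induction \<alpha>) (simp_all add: right_creation_tens right_creation_basis)

text \<open>$I \otimes T$; the family on the right is square-summable because $T$ is bounded.\<close>

definition ampl :: "('a::complex_inner \<Rightarrow> 'b::complex_inner) \<Rightarrow> ('w, 'a) ell2 \<Rightarrow> ('w, 'b) ell2" where
  "ampl T f = Abs_ell2 (\<lambda>w. T (component f w))"

lemma component_ampl:
  assumes "bounded_clinear T"
  shows "component (ampl T f) w = T (component f w)"
proof -
  obtain K where K: "norm (T x) \<le> norm x * K" for x
    using assms bounded_linear.bounded unfolding bounded_clinear_def by blast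
  have "(\<lambda>w. (norm (T (component f w)))\<^sup>2) summable_on UNIV"
  proof (rule summable_on_le[where g = "\<lambda>w. (norm (component f w))\<^sup>2 * K\<^sup>2"])
    show "(\<lambda>w. (norm (component f w))\<^sup>2 * K\<^sup>2) summable_on UNIV"
      by (intro summable_on_cmult_left component_summable)
    show "\<bar>(norm (T (component f w)))\<^sup>2\<bar> \<le> (norm (component f w))\<^sup>2 * K\<^sup>2" for w
      using power_mono[OF K[of "component f w"] norm_ge_zero, of 2] by (simp add: power_mult_distrib)
  qed
  then show ?thesis by (simp add: ampl_def Abs_ell2_inverse)
qed

lemma ampl_tens:
  assumes "bounded_clinear T" shows "ampl T (f \<otimes> h) = f \<otimes> T h"
  by (rule ell2_eqI) (use assms in \<open>simp add: component_ampl tens.rep_eq bounded_clinear_def\<close>)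

text \<open>$\mathcal P_k \otimes K$\<close>

definition polys :: "nat \<Rightarrow> ('i, 'a::real_inner) fock_tensor set" where
  "polys k = {q. \<forall>\<alpha>. k < length \<alpha> \<longrightarrow> component q \<alpha> = 0}"

text \<open>The coefficient $\phi_{(\alpha)}$; the word is reversed in the defining relation.\<close>

definition fcoeff :: "('a::complex_inner \<Rightarrow> ('i, 'b::complex_inner) fock_tensor) \<Rightarrow> 'i list \<Rightarrow> 'a \<Rightarrow> 'b" where
  "fcoeff \<phi> \<alpha> = (THE T. \<forall>h h'. cinner (T h) h' = cinner (\<phi> h) (basis_vec (rev \<alpha>) \<otimes> h'))"

lemma fcoeff_eq: "fcoeff \<phi> \<alpha> h = component (\<phi> h) (rev \<alpha>)"
proof -
  have "fcoeff \<phi> \<alpha> = (\<lambda>h. component (\<phi> h) (rev \<alpha>))"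
    unfolding fcoeff_def cinner_basis_tens
  proof (rule the_equality)
    fix T assume "\<forall>h h'. cinner (T h) h' = cinner (component (\<phi> h) (rev \<alpha>)) h'"
    then show "T = (\<lambda>h. component (\<phi> h) (rev \<alpha>))"
      by (intro ext) (rule cinner_extensionality, simp)
  qed simp
  then show ?thesis by simp
qed

lemma cinner_fcoeff: "cinner (fcoeff \<phi> (rev \<alpha>) h) h' = cinner (\<phi> h) (basis_vec \<alpha> \<otimes> h')"
  by (simp add: fcoeff_eq cinner_basis_tens)

text \<open>$M_\phi$ applied to $q = \sum_\alpha e_\alpha \otimes q_\alpha$ is
  $\sum_\alpha (S_\alpha \otimes I) \phi q_\alpha$. For a bounded \<^term>\<open>\<phi>\<close> the series converges in norm
  on every \<^term>\<open>polys k\<close> (the summands with \<^term>\<open>length \<alpha> = p\<close> are pairwise orthogonal), and only the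
  values there are used.\<close>

definition mult_op ::
    "('a::complex_inner \<Rightarrow> ('i, 'b::complex_inner) fock_tensor) \<Rightarrow> ('i, 'a) fock_tensor \<Rightarrow> ('i, 'b) fock_tensor" where
  "mult_op \<phi> q = (\<Sum>\<^sub>\<infinity>\<alpha>. word_op left_creation \<alpha> (\<phi> (component q \<alpha>)))"

lemma left_creation_zero: "left_creation i 0 = 0"
  by (rule ell2_eqI) (simp add: left_creation.rep_eq)

lemma word_op_left_creation_zero: "word_op left_creation \<alpha> 0 = 0"
  by (induction \<alpha>) (simp_all add: left_creation_zero)

lemma mult_op_basis_tens:
  assumes "bounded_clinear \<phi>"
  shows "mult_op \<phi> (basis_vec \<alpha> \<otimes> h) = word_op left_creation \<alpha> (\<phi> h)"
proof -
  have "\<phi> 0 = 0" using assms by (simp add: bounded_clinear_def linear_simps)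
  then have "mult_op \<phi> (basis_vec \<alpha> \<otimes> h) = (\<Sum>\<^sub>\<infinity>\<beta>\<in>{\<alpha>}. word_op left_creation \<beta> (\<phi> h))"
    unfolding mult_op_def
    by (intro infsum_cong_neutral) (auto simp: component_basis_tens word_op_left_creation_zero)
  then show ?thesis by simp
qed

text \<open>$\Theta = \sum_{|\alpha| \le m} R_\alpha \otimes \theta_{(\alpha)}$; a finite sum for finitely many generators,
  and for infinitely many generators a strongly convergent one as soon as \<open>symbol_bounded m \<theta>\<close> holds.\<close>

definition Theta_op ::
    "nat \<Rightarrow> ('i list \<Rightarrow> 'a::complex_inner \<Rightarrow> 'b::complex_inner) \<Rightarrow> ('i, 'a) fock_tensor \<Rightarrow> ('i, 'b) fock_tensor" where
  "Theta_op m \<theta> q = (\<Sum>\<^sub>\<infinity>\<alpha>\<in>{\<alpha>. length \<alpha> \<le> m}. word_op right_creation \<alpha> (ampl (\<theta> \<alpha>) q))"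

text \<open>$h \mapsto \sum_{|\alpha| \le m} e_{\tilde\alpha} \otimes \theta_{(\alpha)} h$ is a bounded operator.\<close>

definition symbol_bounded :: "nat \<Rightarrow> ('i list \<Rightarrow> 'a::complex_inner \<Rightarrow> 'b::complex_inner) \<Rightarrow> bool" where
  "symbol_bounded m \<theta> \<longleftrightarrow> (\<exists>\<psi> :: 'a \<Rightarrow> ('i, 'b) fock_tensor. bounded_clinear \<psi> \<and>
     (\<forall>h. ((\<lambda>\<alpha>. basis_vec (rev \<alpha>) \<otimes> \<theta> \<alpha> h) has_sum \<psi> h) {\<alpha>. length \<alpha> \<le> m}))"

end

theory Submission
  imports Defs
begin

text \<open>Write $\phi_\beta$ for the component of $\phi$ at the word $\beta$. Then $M_\phi$ is a convolution,
  $(M_\phi q)_\gamma = \sum_{\gamma = \alpha\beta} \phi_\beta q_\alpha$, and the component of $\Theta q$ at a word of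
  length at most $m$ is the same sum, with $\theta_{(\tilde\beta)}$ in place of $\phi_\beta$. This gives necessity.
  For sufficiency the coefficients are found one degree at a time. Suppose that the compression of
  $M_\phi|_{\mathcal P_k}$ to degree at most $j$ is a contraction $T$. The components of degree $j + 1$ of
  $M_\phi q$ are already determined on the space $W$ of those $q$ whose constant term vanishes, and
  for such $q = \sum_i S_i q_i$ the contractivity at degree $j + 1$ is the contractivity at degree $j$
  applied to the $q_i$. So the map $D$ from $W$ to the degree $j + 1$ part satisfies
  $\|Dq\|^2 \le \|q\|^2 - \|Tq\|^2$, and a form of Parrott's theorem extends it to all $q$ with the same
  bound; its values on constants are the coefficients of degree $j + 1$.\<close>

section \<open>Extension of contractions\<close>

text \<open>By Pythagoras the partial sums over finite sets are Cauchy as soon as the real sums of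
  squares are. With infinitely many generators the series for \<open>mult_op\<close> and
  \<open>Theta_op\<close> are controlled only in this square-summable sense.\<close>

lemma orthogonal_summable:
  fixes f :: "'w \<Rightarrow> 'h::chilbert"
  assumes orth: "pairwise (\<lambda>x y. orthogonal (f x) (f y)) A"
    and sq: "(\<lambda>x. (norm (f x))\<^sup>2) summable_on A"
  shows "f summable_on A"
proof -
  let ?n = "\<lambda>x. (norm (f x))\<^sup>2"
  obtain L where L: "(?n has_sum L) A"
    using sq by (auto simp: summable_on_def)
  have "\<exists>P. eventually P (finite_subsets_at_top A) \<and>
      (\<forall>F F'. P F \<and> P F' \<longrightarrow> dist (sum f F) (sum f F') < e)" if "0 < e" for e
  proof -
    \<comment> \<open>Two sums of squares, each within \<open>d\<close> of \<open>L\<close>, differ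
      by less than \<open>2 * d\<close>, which is the square of \<open>e/2\<close>.\<close>
    define d where "d = (e/2)\<^sup>2 / 2"
    have "0 < d" using that by (simp add: d_def)
    then have "eventually (\<lambda>G. dist (sum ?n G) L < d) (finite_subsets_at_top A)"
      using L unfolding has_sum_def by (rule tendstoD[rotated])
    then obtain F0 where F0: "finite F0" "F0 \<subseteq> A"
      and close: "\<And>G. finite G \<Longrightarrow> F0 \<subseteq> G \<Longrightarrow> G \<subseteq> A \<Longrightarrow> dist (sum ?n G) L < d"
      unfolding eventually_finite_subsets_at_top by auto
    have near: "dist (sum f G) (sum f F0) < e/2" if G: "finite G" "F0 \<subseteq> G" "G \<subseteq> A" for G
    proof -
      have "(norm (sum f (G - F0)))\<^sup>2 = sum ?n (G - F0)"
        using G orth by (intro norm_sum_Pythagorean) (auto intro: pairwise_subset)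
      also have "\<dots> = sum ?n G - sum ?n F0"
        using G by (simp add: sum_diff)
      also have "\<dots> < (e/2)\<^sup>2"
        using close[OF G] close[OF F0(1) order_refl F0(2)] unfolding dist_real_def d_def by linarith
      finally have "norm (sum f (G - F0)) < e/2"
        by (rule power2_less_imp_less) (use \<open>0 < e\<close> in auto)
      moreover have "sum f (G - F0) = sum f G - sum f F0"
        using G by (simp add: sum_diff)
      ultimately show ?thesis by (simp add: dist_norm)
    qed
    define P where "P F \<longleftrightarrow> finite F \<and> F0 \<subseteq> F \<and> F \<subseteq> A" for F
    have "dist (sum f F) (sum f F') < e" if "P F" "P F'" for F F'
      by (rule dist_triangle_half_l[where y = "sum f F0"]) (use near that in \<open>auto simp: P_def\<close>)
    moreover have "eventually P (finite_subsets_at_top A)"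
      unfolding eventually_finite_subsets_at_top P_def using F0 by (intro exI[of _ F0]) simp
    ultimately show ?thesis by (intro exI[of _ P]) simp
  qed
  then have "cauchy_filter (filtermap (sum f) (finite_subsets_at_top A))"
    by (simp add: cauchy_filter_metric_filtermap)
  then obtain S where "filtermap (sum f) (finite_subsets_at_top A) \<le> nhds S"
    using cauchy_filter_complete_converges[OF _ complete_UNIV_cuspace, of "filtermap (sum f) (finite_subsets_at_top A)"]
    by (auto simp: filtermap_bot_iff)
  then show ?thesis
    by (auto simp: summable_on_def has_sum_def filterlim_def)
qed

section \<open>Bounded complex-linear maps\<close>

lemma bounded_clinear_simps:
  assumes "bounded_clinear T"
  shows "T (x + y) = T x + T y" "T (x - y) = T x - T y" "T (r *\<^sub>R x) = r *\<^sub>R T x"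
    "T (c *\<^sub>C x) = c *\<^sub>C T x" "T 0 = 0"
  using assms by (auto simp: bounded_clinear_def linear_simps)

lemma bounded_clinearI:
  assumes "\<And>x y. T (x + y) = T x + T y" "\<And>c x. T (c *\<^sub>C x) = c *\<^sub>C T x"
    and "\<And>x. norm (T x) \<le> norm x * K"
  shows "bounded_clinear T"
  unfolding bounded_clinear_def
proof
  show "bounded_linear T"
    using assms(1) assms(2)[of "complex_of_real _"] assms(3)
    by (intro bounded_linear_intro[of T K]) (auto simp: scaleC_of_real)
qed (use assms in auto)

lemma bounded_clinear_compose:
  "bounded_clinear T \<Longrightarrow> bounded_clinear S \<Longrightarrow> bounded_clinear (\<lambda>x. T (S x))"
  by (auto simp: bounded_clinear_def intro: bounded_linear_compose)

lemma inner_scaleC_left: "inner (c *\<^sub>C x) y = inner x (cnj c *\<^sub>C (y :: 'a::complex_inner))"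
  by (simp add: inner_eq_Re_cinner cinner_scaleC_left cinner_scaleC_right)

text \<open>The form $\langle v, v'\rangle - \langle Tv, Tv'\rangle$ is a positive semidefinite inner product for which
  \<^term>\<open>D\<close> is a contraction on \<^term>\<open>W\<close>; the extension is \<^term>\<open>D\<close> composed with the
  orthogonal projection, in this inner product, onto the completion of \<^term>\<open>W\<close>. The relation \<open>R\<close>
  describes the values of this composition by approximate projections in \<^term>\<open>W\<close> itself.\<close>

lemma parrott_extension:
  fixes T :: "'v::complex_inner \<Rightarrow> 'w::complex_inner" and D :: "'v \<Rightarrow> 'g::chilbert"
  assumes T: "bounded_clinear T" and T_le: "\<And>v. norm (T v) \<le> norm v"
    and W0: "0 \<in> W" and Wadd: "\<And>x y. x \<in> W \<Longrightarrow> y \<in> W \<Longrightarrow> x + y \<in> W"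
    and Wscale: "\<And>c x. x \<in> W \<Longrightarrow> c *\<^sub>C x \<in> W"
    and Dadd: "\<And>x y. x \<in> W \<Longrightarrow> y \<in> W \<Longrightarrow> D (x + y) = D x + D y"
    and Dscale: "\<And>c x. x \<in> W \<Longrightarrow> D (c *\<^sub>C x) = c *\<^sub>C D x"
    and bound: "\<And>x. x \<in> W \<Longrightarrow> (norm (T x))\<^sup>2 + (norm (D x))\<^sup>2 \<le> (norm x)\<^sup>2"
  obtains D' where "bounded_clinear D'" "\<And>x. x \<in> W \<Longrightarrow> D' x = D x"
    "\<And>v. (norm (T v))\<^sup>2 + (norm (D' v))\<^sup>2 \<le> (norm v)\<^sup>2"
proof -
  note Ts = bounded_clinear_simps[OF T]
  have WscaleR: "r *\<^sub>R x \<in> W" and DscaleR: "D (r *\<^sub>R x) = r *\<^sub>R D x" if "x \<in> W" for r x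
    using Wscale[OF that, of "complex_of_real r"] Dscale[OF that, of "complex_of_real r"]
    by (simp_all add: scaleC_of_real)
  have Wdiff: "x - y \<in> W" and Ddiff: "D (x - y) = D x - D y" if "x \<in> W" "y \<in> W" for x y
    using Wadd[OF that(1) WscaleR[OF that(2), of "-1"]] Dadd[OF that(1) WscaleR[OF that(2), of "-1"]]
      DscaleR[OF that(2), of "-1"] by simp_all
  \<comment> \<open>\<open>b\<close> is the real part of the form, and complex scalars are moved
    across it by \<open>b_scaleC\<close>. Its seminorm \<open>s\<close> may vanish on nonzero
    vectors, which is why \<open>s u = 0\<close> is a separate case below.\<close>
  define b where "b x y = inner x y - inner (T x) (T y)" for x y
  define s where "s x = sqrt (b x x)" for x
  have b_simps: "b (x + y) z = b x z + b y z" "b z (x + y) = b z x + b z y" "b (x - y) z = b x z - b y z"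
    "b z (x - y) = b z x - b z y" "b (r *\<^sub>R x) z = r * b x z" "b z (r *\<^sub>R x) = r * b z x" for x y z r
    by (simp_all add: b_def Ts algebra_simps inner_simps)
  have b_comm: "b x y = b y x" for x y by (simp add: b_def inner_commute)
  have b_scaleC: "b (c *\<^sub>C x) y = b x (cnj c *\<^sub>C y)" for c x y
    by (simp add: b_def Ts inner_scaleC_left)
  have bb: "b x x = (norm x)\<^sup>2 - (norm (T x))\<^sup>2" for x by (simp add: b_def power2_norm_eq_inner)
  have b_nonneg: "0 \<le> b x x" for x
    using power_mono[OF T_le norm_ge_zero, where n = 2] by (simp add: bb)
  have s_sq: "(s x)\<^sup>2 = b x x" and s_nonneg: "0 \<le> s x" for x by (simp_all add: s_def b_nonneg)
  have s_scaleC: "s (c *\<^sub>C x) = cmod c * s x" for c x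
  proof -
    have "b (c *\<^sub>C x) (c *\<^sub>C x) = (cmod c)\<^sup>2 * b x x"
      by (simp add: bb Ts norm_scaleC power_mult_distrib right_diff_distrib)
    then show ?thesis by (simp add: s_def real_sqrt_mult)
  qed
  have D_le: "norm (D x) \<le> s x" if "x \<in> W" for x
    by (rule power2_le_imp_le[OF _ s_nonneg]) (use bound[OF that] s_sq[of x] in \<open>simp add: bb\<close>)
  \<comment> \<open>The approximate projections of \<open>v\<close>: the residual
    \<open>v - w\<close> is orthogonal to \<open>W\<close> up to \<open>e\<close>. An exact
    projection may fail to exist, as \<open>W\<close> need not be complete for
    \<open>s\<close>.\<close>
  define A where "A e v = {w \<in> W. \<forall>u\<in>W. \<bar>b (v - w) u\<bar> \<le> e * s u}" for e v
  have A_nonempty: "\<exists>w. w \<in> A e v" if "0 < e" for e v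
  proof -
    let ?I = "(\<lambda>w. b (v - w) (v - w)) ` W"
    have bdd: "bdd_below ?I" using b_nonneg by (auto intro!: bdd_belowI[of _ 0])
    have "Inf ?I < Inf ?I + e\<^sup>2" using that by simp
    \<comment> \<open>A near-minimiser of the squared \<open>s\<close>-distance from
      \<open>v\<close> to \<open>W\<close>. The tolerance must be quadratic in \<open>e\<close> for
      the first variation to be linear in \<open>e\<close>.\<close>
    then obtain w where w: "w \<in> W" "b (v - w) (v - w) < Inf ?I + e\<^sup>2"
      using cInf_lessD[of ?I "Inf ?I + e\<^sup>2"] W0 by blast
    have "\<bar>b (v - w) u\<bar> \<le> e * s u" if u: "u \<in> W" for u
    proof -
      \<comment> \<open>Moving \<open>w\<close> by \<open>t *\<^sub>R u\<close> inside
        \<open>W\<close> lowers the squared distance by less than the tolerance. This gives a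
        quadratic inequality in \<open>t\<close>, to be used at well-chosen values.\<close>
      have q: "2 * t * b (v - w) u \<le> e\<^sup>2 + t\<^sup>2 * b u u" for t
      proof -
        have "Inf ?I \<le> b (v - (w + t *\<^sub>R u)) (v - (w + t *\<^sub>R u))"
          by (rule cInf_lower[OF _ bdd]) (use w u in \<open>auto intro!: imageI Wadd WscaleR\<close>)
        also have "\<dots> = b (v - w) (v - w) - 2 * t * b (v - w) u + t\<^sup>2 * b u u"
          using b_comm[of u v] b_comm[of u w] b_comm[of w v]
          by (simp add: b_simps power2_eq_square algebra_simps)
        finally show ?thesis using w by simp
      qed
      show ?thesis
      proof (cases "s u = 0")
        case True
        then have "b u u = 0" using s_sq[of u] by simp
        have "b (v - w) u = 0"
        proof (rule ccontr)
          \<comment> \<open>With \<open>b u u = 0\<close> the inequality is linear in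
            \<open>t\<close>; the value of \<open>t\<close> chosen here makes its left side twice
            its right side.\<close>
          assume "b (v - w) u \<noteq> 0"
          then show False
            using q[of "e\<^sup>2 / b (v - w) u"] \<open>b u u = 0\<close> \<open>0 < e\<close> by simp
        qed
        then show ?thesis using True by simp
      next
        case False
        then have su: "0 < s u" using s_nonneg[of u] by simp
        define x where "x = b (v - w) u"
        \<comment> \<open>The value \<open>t = e / s u\<close> balances the two terms on the right,
          and the two signs of \<open>t\<close> give the absolute value.\<close>
        have "2 * (e / s u) * \<bar>x\<bar> \<le> e\<^sup>2 + (e / s u)\<^sup>2 * b u u"
          using q[of "e / s u"] q[of "- (e / s u)"] unfolding x_def[symmetric] by (cases "0 \<le> x") auto
        also have "\<dots> = 2 * e\<^sup>2" using su by (simp add: power_divide flip: s_sq)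
        finally show ?thesis using su \<open>0 < e\<close>
          by (simp add: x_def[symmetric] power2_eq_square field_simps)
      qed
    qed
    then show ?thesis using w by (auto simp: A_def)
  qed
  have A_mono: "w \<in> A e' v" if "w \<in> A e v" "e \<le> e'" for e e' v w
    using that(1) mult_right_mono[OF that(2) s_nonneg] unfolding A_def by (blast intro: order_trans)
  \<comment> \<open>The difference of two approximate projections lies in \<open>W\<close>, so both
    orthogonality conditions may be tested against that difference itself.\<close>
  have A_close: "s (w - w') \<le> 2 * e" if "0 < e" "w \<in> A e v" "w' \<in> A e v" for e v w w'
  proof -
    let ?u = "w - w'"
    have u: "?u \<in> W" using that Wdiff by (auto simp: A_def)
    have "(s ?u)\<^sup>2 = b (v - w') ?u - b (v - w) ?u"
      by (simp add: s_sq b_simps)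
    also have "\<dots> \<le> 2 * e * s ?u"
    proof -
      have "\<bar>b (v - w') ?u\<bar> \<le> e * s ?u" "\<bar>b (v - w) ?u\<bar> \<le> e * s ?u"
        using that(2,3) u by (auto simp: A_def)
      then show ?thesis by linarith
    qed
    finally show ?thesis
      using s_nonneg[of ?u] \<open>0 < e\<close> by (cases "s ?u = 0") (simp_all add: power2_eq_square)
  qed
  define R where "R v y \<longleftrightarrow> (\<forall>e>0. \<exists>w\<in>A e v. norm (D w - y) \<le> e)" for v y
  have R_ex: "\<exists>y. R v y" for v
  proof -
    have "\<forall>n. \<exists>w. w \<in> A (1 / Suc n) v" using A_nonempty by simp
    then obtain w where w: "\<And>n. w n \<in> A (1 / Suc n) v" by metis
    have wW: "w n \<in> W" for n using w by (auto simp: A_def)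
    \<comment> \<open>Since \<open>D\<close> is dominated by \<open>s\<close> on \<open>W\<close>,
      closeness of the projections carries over to their images; completeness of the target then
      supplies the limit.\<close>
    have close: "norm (D (w m) - D (w n)) \<le> 2 / Suc N" if "N \<le> m" "N \<le> n" for m n N
    proof -
      have "w m \<in> A (1 / Suc N) v" "w n \<in> A (1 / Suc N) v"
        using that by (auto intro!: A_mono[OF w] frac_le)
      then have "s (w m - w n) \<le> 2 * (1 / Suc N)" by (intro A_close) auto
      then show ?thesis using D_le[OF Wdiff[OF wW wW], of m n] Ddiff[OF wW wW, of m n] by simp
    qed
    have "Cauchy (\<lambda>n. D (w n))"
    proof (rule CauchyI)
      fix e :: real assume "0 < e"
      then obtain N where N: "1 / Suc N < e / 2" using nat_approx_posE half_gt_zero by blast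
      then have "2 / Suc N < e" by (simp add: field_simps)
      then show "\<exists>M. \<forall>m\<ge>M. \<forall>n\<ge>M. norm (D (w m) - D (w n)) < e"
        using close by (meson le_less_trans)
    qed
    then obtain y where y: "(\<lambda>n. D (w n)) \<longlonglongrightarrow> y"
      by (auto simp: Cauchy_convergent_iff convergent_def)
    have "R v y" unfolding R_def
    proof (intro allI impI)
      fix e :: real assume "0 < e"
      obtain N where N: "\<And>n. n \<ge> N \<Longrightarrow> norm (D (w n) - y) < e"
        using LIMSEQ_D[OF y \<open>0 < e\<close>] by blast
      obtain M where M: "1 / Suc M < e" using \<open>0 < e\<close> nat_approx_posE by blast
      have "1 / Suc (max N M) \<le> 1 / Suc M" by (intro frac_le) auto
      then have "w (max N M) \<in> A e v" using M by (intro A_mono[OF w]) auto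
      then show "\<exists>w\<in>A e v. norm (D w - y) \<le> e"
        using N[of "max N M"] by (intro bexI[of _ "w (max N M)"]) auto
    qed
    then show ?thesis ..
  qed
  have R_add: "R (v + v') (y + y')" if R: "R v y" "R v' y'" for v v' y y'
    unfolding R_def
  proof (intro allI impI)
    fix e :: real assume "0 < e"
    then have "0 < e/2" by simp
    then obtain w w' where w: "w \<in> A (e/2) v" "norm (D w - y) \<le> e/2"
      and w': "w' \<in> A (e/2) v'" "norm (D w' - y') \<le> e/2"
      using R[unfolded R_def, rule_format, OF \<open>0 < e/2\<close>] by blast
    have W: "w \<in> W" "w' \<in> W" using w w' by (auto simp: A_def)
    have "\<bar>b ((v + v') - (w + w')) u\<bar> \<le> e * s u" if "u \<in> W" for u
    proof -
      have "\<bar>b (v - w) u\<bar> \<le> e/2 * s u" "\<bar>b (v' - w') u\<bar> \<le> e/2 * s u"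
        using w w' that by (auto simp: A_def)
      then show ?thesis unfolding b_simps by linarith
    qed
    then have "w + w' \<in> A e (v + v')" using Wadd W by (simp add: A_def)
    moreover have "norm (D (w + w') - (y + y')) \<le> e"
      using norm_triangle_ineq[of "D w - y" "D w' - y'"] w(2) w'(2)
      by (simp add: Dadd W algebra_simps)
    ultimately show "\<exists>w\<in>A e (v + v'). norm (D w - (y + y')) \<le> e" by blast
  qed
  have R_scale: "R (c *\<^sub>C v) (c *\<^sub>C y)" if R: "R v y" for v c y
    unfolding R_def
  proof (intro allI impI)
    fix e :: real assume "0 < e"
    define d where "d = e / (cmod c + 1)"
    have d: "0 < d" "cmod c * d \<le> e"
      using \<open>0 < e\<close> by (auto simp: d_def field_simps add_pos_nonneg)
    obtain w where w: "w \<in> A d v" "norm (D w - y) \<le> d"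
      using R d unfolding R_def by blast
    have W: "w \<in> W" using w by (auto simp: A_def)
    have C: "c *\<^sub>C x - c *\<^sub>C y = c *\<^sub>C (x - y)" for x y :: "'x::complex_inner"
      by (metis add_diff_cancel diff_add_cancel scaleC_add_right)
    have "\<bar>b (c *\<^sub>C v - c *\<^sub>C w) u\<bar> \<le> e * s u" if "u \<in> W" for u
    proof -
      have "\<bar>b (c *\<^sub>C v - c *\<^sub>C w) u\<bar> \<le> d * s (cnj c *\<^sub>C u)"
        using w Wscale[OF that, of "cnj c"] by (simp add: A_def C b_scaleC)
      also have "\<dots> = (cmod c * d) * s u" by (simp add: s_scaleC)
      also have "\<dots> \<le> e * s u" by (intro mult_right_mono d s_nonneg)
      finally show ?thesis .
    qed
    then have "c *\<^sub>C w \<in> A e (c *\<^sub>C v)" using Wscale W by (simp add: A_def)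
    moreover have "norm (D (c *\<^sub>C w) - c *\<^sub>C y) \<le> e"
      using mult_left_mono[OF w(2), of "cmod c"] d(2) by (simp add: Dscale W C norm_scaleC)
    ultimately show "\<exists>w\<in>A e (c *\<^sub>C v). norm (D w - c *\<^sub>C y) \<le> e" by blast
  qed
  \<comment> \<open>A vector of \<open>W\<close> is its own exact projection.\<close>
  have R_on_W: "R x (D x)" if "x \<in> W" for x
    using that s_nonneg by (auto simp: R_def A_def b_def Ts intro!: bexI[of _ x])
  have R_le: "norm y \<le> s v" if R: "R v y" for v y
  proof (rule field_le_epsilon)
    fix e :: real assume "0 < e"
    \<comment> \<open>A third of \<open>e\<close>: passing from \<open>s v\<close> to
      \<open>s w\<close> costs \<open>2 * d\<close>, and passing from \<open>D w\<close> to
      \<open>y\<close> costs \<open>d\<close>.\<close>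
    define d where "d = e / 3"
    have "0 < d" using \<open>0 < e\<close> by (simp add: d_def)
    then obtain w where w: "w \<in> A d v" "norm (D w - y) \<le> d"
      using R unfolding R_def by blast
    have W: "w \<in> W" and "\<bar>b (v - w) w\<bar> \<le> d * s w" using w by (auto simp: A_def)
    moreover have "b v v = b (v - w) (v - w) + (s w)\<^sup>2 + 2 * b (v - w) w"
      using b_comm[of w v] by (simp add: b_simps s_sq)
    ultimately have "(s w)\<^sup>2 - 2 * d * s w \<le> (s v)\<^sup>2"
      using b_nonneg[of "v - w"] s_sq[of v] by (simp add: abs_le_iff)
    \<comment> \<open>Approximate form of the fact that a projection does not increase the seminorm;
      the cross term between \<open>v - w\<close> and \<open>w\<close> is absorbed by
      \<open>2 * d\<close>.\<close>
    have "s w \<le> s v + 2 * d"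
    proof (rule ccontr)
      assume "\<not> ?thesis"
      then have gt: "s v + 2 * d < s w" by simp
      have "(s v) * (s v) \<le> s v * s w" using gt \<open>0 < d\<close> s_nonneg[of v] by (intro mult_left_mono) auto
      moreover have "s v * s w < (s w - 2 * d) * s w"
        using gt s_nonneg[of v] \<open>0 < d\<close> by (intro mult_strict_right_mono) auto
      ultimately show False
        using \<open>(s w)\<^sup>2 - 2 * d * s w \<le> (s v)\<^sup>2\<close> by (simp add: power2_eq_square algebra_simps)
    qed
    have "norm y \<le> norm (D w) + norm (D w - y)"
      using norm_triangle_ineq4[of "D w" "D w - y"] by simp
    then show "norm y \<le> s v + e"
      using \<open>s w \<le> s v + 2 * d\<close> D_le[OF W] w(2) \<open>0 < e\<close> by (simp add: d_def)
  qed
  have minus_one: "(- 1) *\<^sub>C x = - x" for x :: "'x::complex_inner"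
    using scaleC_of_real[of "- 1" x] by simp
  \<comment> \<open>By additivity and homogeneity the difference of two values at \<open>v\<close>
    is a value at 0, where the seminorm vanishes.\<close>
  have R_unique: "y = y'" if "R v y" "R v y'" for v y y'
  proof -
    have "R (v + (- 1) *\<^sub>C v) (y + (- 1) *\<^sub>C y')"
      using that by (intro R_add R_scale)
    from R_le[OF this] show ?thesis by (simp add: minus_one s_def b_def Ts)
  qed
  obtain D' where D': "\<And>v. R v (D' v)"
    using R_ex by metis
  have D'_le: "(norm (T v))\<^sup>2 + (norm (D' v))\<^sup>2 \<le> (norm v)\<^sup>2" for v
    using power_mono[OF R_le[OF D'[of v]] norm_ge_zero, where n = 2] by (simp add: s_sq bb)
  show ?thesis
  proof
    show "bounded_clinear D'"
    proof (rule bounded_clinearI[where K = 1])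
      show "D' (x + y) = D' x + D' y" for x y
        by (rule R_unique[OF D' R_add[OF D' D']])
      show "D' (c *\<^sub>C x) = c *\<^sub>C D' x" for c x
        by (rule R_unique[OF D' R_scale[OF D']])
      show "norm (D' x) \<le> norm x * 1" for x
      proof -
        have "(norm (D' x))\<^sup>2 \<le> (norm x)\<^sup>2"
          using D'_le[of x] zero_le_power2[of "norm (T x)"] by linarith
        then show ?thesis by simp
      qed
    qed
    show "D' x = D x" if "x \<in> W" for x
      by (rule R_unique[OF D' R_on_W[OF that]])
  qed (rule D'_le)
qed

section \<open>The operators on the Fock space as convolutions\<close>

lemma component_Abs_ell2:
  assumes "\<And>F. finite F \<Longrightarrow> (\<Sum>w\<in>F. (norm (f w))\<^sup>2) \<le> r"
  shows "component (Abs_ell2 f) w = f w"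
proof -
  have "(\<lambda>w. (norm (f w))\<^sup>2) summable_on UNIV"
    by (rule nonneg_bdd_above_summable_on) (use assms in \<open>auto intro!: bdd_aboveI2[where M = r]\<close>)
  then show ?thesis by (simp add: Abs_ell2_inverse)
qed

text \<open>The link to \<open>contr\<close>, which is stated with finite sums so that it makes
  sense before a coefficient family is known to be square-summable.\<close>

lemma ell2_norm_sq_le_iff: "(norm f)\<^sup>2 \<le> r \<longleftrightarrow> (\<forall>F. finite F \<longrightarrow> (\<Sum>w\<in>F. (norm (component f w))\<^sup>2) \<le> r)"
proof
  show "(norm f)\<^sup>2 \<le> r \<Longrightarrow> \<forall>F. finite F \<longrightarrow> (\<Sum>w\<in>F. (norm (component f w))\<^sup>2) \<le> r"
    using sum_component_le[of _ f] by (meson order_trans)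
  show "\<forall>F. finite F \<longrightarrow> (\<Sum>w\<in>F. (norm (component f w))\<^sup>2) \<le> r \<Longrightarrow> (norm f)\<^sup>2 \<le> r"
    unfolding norm_ell2_sq by (rule infsum_le_finite_sums[OF component_summable]) auto
qed

lemma ell2_norm_le:
  assumes "\<And>w. norm (component f w) \<le> norm (component g w)"
  shows "norm f \<le> norm g"
proof -
  have "(norm f)\<^sup>2 \<le> (norm g)\<^sup>2"
    unfolding norm_ell2_sq using assms by (intro infsum_mono component_summable power_mono) auto
  then show ?thesis by simp
qed

lemma ell2_norm_reindex:
  assumes "inj e" "\<And>w. component g (e w) = component f w" "\<And>v. v \<notin> range e \<Longrightarrow> component g v = 0"
  shows "norm g = norm f"
proof -
  have "(norm g)\<^sup>2 = (\<Sum>\<^sub>\<infinity>v\<in>range e. (norm (component g v))\<^sup>2)"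
    unfolding norm_ell2_sq using assms(3) by (intro infsum_cong_neutral) auto
  also have "\<dots> = (norm f)\<^sup>2"
    using assms(1,2) by (simp add: infsum_reindex norm_ell2_sq o_def)
  finally show ?thesis by simp
qed

lemma orthogonal_disjoint_support:
  assumes "\<And>w. component f w = 0 \<or> component g w = 0"
  shows "orthogonal f g"
proof -
  have "inner (component f w) (component g w) = 0" for w using assms[of w] by auto
  then show ?thesis by (simp add: orthogonal_def inner_ell2_def)
qed

lemma bounded_clinear_component: "bounded_clinear (\<lambda>f. component f w)"
  by (rule bounded_clinearI[where K = 1]) (simp_all add: norm_component_le)

lemma norm_basis_tens: "norm (basis_vec v \<otimes> h) = norm h"
proof -
  have "(norm (basis_vec v \<otimes> h))\<^sup>2 = (\<Sum>\<^sub>\<infinity>w\<in>{v}. (norm h)\<^sup>2)"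
    unfolding norm_ell2_sq by (rule infsum_cong_neutral) (auto simp: component_basis_tens)
  then show ?thesis by simp
qed

lemma bounded_clinear_basis_tens: "bounded_clinear (\<lambda>h. basis_vec v \<otimes> h)"
  by (rule bounded_clinearI[where K = 1])
    (auto simp: norm_basis_tens component_basis_tens intro!: ell2_eqI)

lemma bounded_clinear_add:
  "bounded_clinear S \<Longrightarrow> bounded_clinear T \<Longrightarrow> bounded_clinear (\<lambda>x. S x + T x)"
  by (auto simp: bounded_clinear_def scaleC_add_right intro: bounded_linear_add)

lemma bounded_clinear_0: "bounded_clinear (\<lambda>x. 0)"
  by (rule bounded_clinearI[where K = 0]) auto

lemma bounded_clinear_sum:
  "(\<And>i. i \<in> I \<Longrightarrow> bounded_clinear (T i)) \<Longrightarrow> bounded_clinear (\<lambda>x. \<Sum>i\<in>I. T i x)"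
  by (induction I rule: infinite_finite_induct) (auto intro: bounded_clinear_0 bounded_clinear_add)

lemma component_has_sum:
  fixes f :: "'x \<Rightarrow> ('w, 'a::complex_inner) ell2"
  assumes "(f has_sum g) A"
  shows "((\<lambda>x. component (f x) w) has_sum component g w) A"
  by (rule has_sum_bounded_linear[OF _ assms])
    (use bounded_clinear_component in \<open>auto simp: bounded_clinear_def\<close>)

lemma has_sum_finite_support:
  fixes f :: "'a \<Rightarrow> 'b::{topological_comm_monoid_add, t2_space}"
  assumes "(f has_sum s) A" "finite B" "B \<subseteq> A" "\<And>x. x \<in> A - B \<Longrightarrow> f x = 0"
  shows "s = sum f B"
  using has_sum_unique[OF assms(1) has_sum_finite_neutralI[OF assms(2-4) refl]] .

lemma has_sum_sum:
  fixes f :: "'i \<Rightarrow> 'a \<Rightarrow> 'b::topological_comm_monoid_add"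
  assumes "\<And>i. i \<in> I \<Longrightarrow> (f i has_sum s i) A"
  shows "((\<lambda>x. \<Sum>i\<in>I. f i x) has_sum (\<Sum>i\<in>I. s i)) A"
  using assms by (induction I rule: infinite_finite_induct) (auto intro: has_sum_add)

section \<open>Words of creation operators in coordinates\<close>

lemma component_word_op_left:
  "component (word_op left_creation \<alpha> f) \<gamma> =
     (if take (length \<alpha>) \<gamma> = \<alpha> then component f (drop (length \<alpha>) \<gamma>) else 0)"
proof (induction \<alpha> arbitrary: \<gamma>)
  case (Cons i \<alpha>)
  then show ?case by (cases \<gamma>) (auto simp: left_creation.rep_eq)
qed simp

text \<open>The last letter of \<alpha> acts first, hence \<open>rev \<alpha>\<close> as suffix. If
  \<gamma> is shorter than \<alpha>, the truncated subtraction is 0 and the test compares words of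
  different lengths, so it fails as it should.\<close>

lemma component_word_op_right:
  "component (word_op right_creation \<alpha> f) \<gamma> =
     (if drop (length \<gamma> - length \<alpha>) \<gamma> = rev \<alpha> then component f (take (length \<gamma> - length \<alpha>) \<gamma>) else 0)"
proof (induction \<alpha> arbitrary: \<gamma>)
  case (Cons i \<alpha>)
  then show ?case by (cases \<gamma> rule: rev_cases) (auto simp: right_creation.rep_eq)
qed simp

lemma norm_word_op_left: "norm (word_op left_creation \<alpha> f) = norm f"
proof (rule ell2_norm_reindex[where e = "\<lambda>\<beta>. \<alpha> @ \<beta>"])
  fix \<gamma> assume "\<gamma> \<notin> range (\<lambda>\<beta>. \<alpha> @ \<beta>)"
  then show "component (word_op left_creation \<alpha> f) \<gamma> = 0"
    by (metis append_take_drop_id component_word_op_left rangeI)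
qed (auto simp: inj_on_def component_word_op_left)

lemma norm_word_op_right: "norm (word_op right_creation \<alpha> f) = norm f"
proof (rule ell2_norm_reindex[where e = "\<lambda>\<beta>. \<beta> @ rev \<alpha>"])
  fix \<gamma> assume "\<gamma> \<notin> range (\<lambda>\<beta>. \<beta> @ rev \<alpha>)"
  then show "component (word_op right_creation \<alpha> f) \<gamma> = 0"
    by (metis append_take_drop_id component_word_op_right rangeI)
qed (auto simp: inj_on_def component_word_op_right)

text \<open>The factorizations of \<gamma> into a prefix and a suffix are indexed by the prefix
  length, so the sum is finite even for infinitely many generators and arbitrary coefficient
  families.\<close>

definition conv :: "('i list \<Rightarrow> 'a \<Rightarrow> 'b::comm_monoid_add) \<Rightarrow> ('i, 'a::real_inner) fock_tensor \<Rightarrow> 'i list \<Rightarrow> 'b" where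
  "conv c q \<gamma> = (\<Sum>p\<le>length \<gamma>. c (drop p \<gamma>) (component q (take p \<gamma>)))"

text \<open>Orthogonality of the terms is available within each word length; this lemma adds up the
  finitely many lengths.\<close>

lemma summable_on_words_le:
  fixes f :: "'i list \<Rightarrow> 'b::topological_comm_monoid_add"
  assumes "\<And>p. p \<le> k \<Longrightarrow> f summable_on {\<alpha>. length \<alpha> = p}"
  shows "f summable_on {\<alpha>. length \<alpha> \<le> k}"
proof -
  have "f summable_on (\<Union>p\<in>{..k}. {\<alpha>. length \<alpha> = p})"
    using assms by (intro summable_on_finite_union_disjoint) auto
  moreover have "(\<Union>p\<in>{..k}. {\<alpha> :: 'i list. length \<alpha> = p}) = {\<alpha>. length \<alpha> \<le> k}" by auto
  ultimately show ?thesis by simp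
qed

text \<open>Distinct prefixes of equal length give disjoint supports, so
  \<open>orthogonal_summable\<close> applies within one length. The degree bound on \<open>q\<close>
  leaves finitely many lengths.\<close>

lemma mult_op_summable:
  fixes \<phi> :: "'a::complex_inner \<Rightarrow> ('i, 'b::chilbert) fock_tensor"
  assumes \<phi>: "bounded_clinear \<phi>" and q: "q \<in> polys k"
  shows "(\<lambda>\<alpha>. word_op left_creation \<alpha> (\<phi> (component q \<alpha>))) summable_on UNIV"
proof -
  let ?t = "\<lambda>\<alpha>. word_op left_creation \<alpha> (\<phi> (component q \<alpha>))"
  obtain K where K: "norm (\<phi> x) \<le> norm x * K" for x
    using \<phi> bounded_linear.bounded unfolding bounded_clinear_def by blast
  have "?t summable_on {\<alpha>. length \<alpha> = p}" for p
  proof (rule orthogonal_summable)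
    show "pairwise (\<lambda>\<alpha> \<beta>. orthogonal (?t \<alpha>) (?t \<beta>)) {\<alpha>. length \<alpha> = p}"
      unfolding pairwise_def
      by (auto intro!: orthogonal_disjoint_support simp: component_word_op_left)
    show "(\<lambda>\<alpha>. (norm (?t \<alpha>))\<^sup>2) summable_on {\<alpha>. length \<alpha> = p}"
    proof (rule summable_on_le)
      show "(\<lambda>\<alpha>. (norm (component q \<alpha>))\<^sup>2 * K\<^sup>2) summable_on {\<alpha>. length \<alpha> = p}"
        by (intro summable_on_cmult_left component_summable)
      show "\<bar>(norm (?t \<alpha>))\<^sup>2\<bar> \<le> (norm (component q \<alpha>))\<^sup>2 * K\<^sup>2" for \<alpha>
        using power_mono[OF K[of "component q \<alpha>"] norm_ge_zero, of 2]
        by (simp add: norm_word_op_left power_mult_distrib)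
    qed
  qed
  then have "?t summable_on {\<alpha>. length \<alpha> \<le> k}" by (intro summable_on_words_le)
  moreover have "?t \<alpha> = 0" if "k < length \<alpha>" for \<alpha>
    using q that by (simp add: polys_def bounded_clinear_simps[OF \<phi>] word_op_left_creation_zero)
  ultimately show ?thesis
    by (subst summable_on_cong_neutral[where T = "{\<alpha>. length \<alpha> \<le> k}" and g = ?t]) auto
qed

lemma component_mult_op:
  fixes \<phi> :: "'a::complex_inner \<Rightarrow> ('i, 'b::chilbert) fock_tensor"
  assumes \<phi>: "bounded_clinear \<phi>" and q: "q \<in> polys k"
  shows "component (mult_op \<phi> q) \<gamma> = conv (\<lambda>\<beta> h. component (\<phi> h) \<beta>) q \<gamma>"
proof -
  let ?t = "\<lambda>\<alpha>. word_op left_creation \<alpha> (\<phi> (component q \<alpha>))"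
  \<comment> \<open>The prefixes of \<gamma>: only for these \<alpha> does the summand reach the
    component at \<gamma>.\<close>
  let ?B = "(\<lambda>p. take p \<gamma>) ` {..length \<gamma>}"
  have inj: "inj_on (\<lambda>p. take p \<gamma>) {..length \<gamma>}"
    by (rule inj_on_inverseI[where g = length]) auto
  have "((\<lambda>\<alpha>. component (?t \<alpha>) \<gamma>) has_sum component (mult_op \<phi> q) \<gamma>) UNIV"
    unfolding mult_op_def by (intro component_has_sum has_sum_infsum mult_op_summable[OF assms])
  then have "component (mult_op \<phi> q) \<gamma> = (\<Sum>\<alpha>\<in>?B. component (?t \<alpha>) \<gamma>)"
  proof (rule has_sum_finite_support)
    fix \<alpha> assume "\<alpha> \<in> UNIV - ?B"
    then have "take (length \<alpha>) \<gamma> \<noteq> \<alpha>"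
      by (metis DiffD2 atMost_iff image_eqI nat_le_linear take_all_iff order_refl)
    then show "component (?t \<alpha>) \<gamma> = 0" by (simp add: component_word_op_left)
  qed auto
  also have "\<dots> = (\<Sum>p\<le>length \<gamma>. component (?t (take p \<gamma>)) \<gamma>)"
    by (simp add: sum.reindex[OF inj])
  also have "\<dots> = conv (\<lambda>\<beta> h. component (\<phi> h) \<beta>) q \<gamma>"
    unfolding conv_def by (intro sum.cong) (auto simp: component_word_op_left min_def)
  finally show ?thesis .
qed

lemma symbol_bounded_finite:
  fixes \<theta> :: "'i list \<Rightarrow> 'a::complex_inner \<Rightarrow> 'b::complex_inner"
  assumes "finite (UNIV :: 'i set)" "\<And>\<alpha>. length \<alpha> \<le> m \<Longrightarrow> bounded_clinear (\<theta> \<alpha>)"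
  shows "symbol_bounded m \<theta>"
proof -
  let ?A = "{\<alpha> :: 'i list. length \<alpha> \<le> m}"
  have fin: "finite ?A"
    using finite_lists_length_le[OF assms(1), of m] by simp
  have "bounded_clinear (\<lambda>h. \<Sum>\<alpha>\<in>?A. basis_vec (rev \<alpha>) \<otimes> \<theta> \<alpha> h)"
    by (intro bounded_clinear_sum bounded_clinear_compose[OF bounded_clinear_basis_tens]) (simp add: assms)
  then show ?thesis
    unfolding symbol_bounded_def using fin by (blast intro: has_sum_finiteI)
qed

text \<open>The values \<open>\<theta> \<alpha> h\<close> are the components of \<psi>
  \<open>h\<close> at the reversed words, so the bound on \<psi> controls all of them jointly,
  uniformly in \<open>F\<close>.\<close>

lemma symbol_bounded_sum:
  fixes \<theta> :: "'i list \<Rightarrow> 'a::complex_inner \<Rightarrow> 'b::complex_inner"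
  assumes "symbol_bounded m \<theta>"
  obtains K where "\<And>F h. finite F \<Longrightarrow> F \<subseteq> {\<alpha>. length \<alpha> \<le> m} \<Longrightarrow> (\<Sum>\<alpha>\<in>F. (norm (\<theta> \<alpha> h))\<^sup>2) \<le> (norm h)\<^sup>2 * K"
proof -
  obtain \<psi> where \<psi>: "bounded_clinear \<psi>"
    and sum: "\<And>h. ((\<lambda>\<alpha>. basis_vec (rev \<alpha>) \<otimes> \<theta> \<alpha> h) has_sum \<psi> h) {\<alpha>. length \<alpha> \<le> m}"
    using assms unfolding symbol_bounded_def by blast
  obtain K where K: "norm (\<psi> x) \<le> norm x * K" for x
    using \<psi> bounded_linear.bounded unfolding bounded_clinear_def by blast
  have c: "component (\<psi> h) (rev \<alpha>) = \<theta> \<alpha> h" if "length \<alpha> \<le> m" for \<alpha> h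
  proof -
    have "component (\<psi> h) (rev \<alpha>) = (\<Sum>\<beta>\<in>{\<alpha>}. component (basis_vec (rev \<beta>) \<otimes> \<theta> \<beta> h) (rev \<alpha>))"
      by (rule has_sum_finite_support[OF component_has_sum[OF sum]])
        (use that in \<open>auto simp: component_basis_tens\<close>)
    then show ?thesis by (simp add: component_basis_tens)
  qed
  have "(\<Sum>\<alpha>\<in>F. (norm (\<theta> \<alpha> h))\<^sup>2) \<le> (norm h)\<^sup>2 * K\<^sup>2" if F: "finite F" "F \<subseteq> {\<alpha>. length \<alpha> \<le> m}" for F h
  proof -
    have "(\<Sum>\<alpha>\<in>F. (norm (\<theta> \<alpha> h))\<^sup>2) = (\<Sum>\<alpha>\<in>rev ` F. (norm (component (\<psi> h) \<alpha>))\<^sup>2)"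
      using F by (subst sum.reindex) (auto simp: inj_on_def c intro!: sum.cong)
    also have "\<dots> \<le> (norm (\<psi> h))\<^sup>2" using F by (intro sum_component_le) simp
    also have "\<dots> \<le> (norm h * K)\<^sup>2" by (intro power_mono K) simp
    finally show ?thesis by (simp add: power_mult_distrib)
  qed
  then show ?thesis by (rule that)
qed

text \<open>For a fixed length the summands have disjoint supports. Bounding the sum of their
  squared norms takes the joint estimate on \<theta>, applied to each component of \<open>q\<close>
  after interchanging the two sums.\<close>

lemma Theta_op_summable:
  fixes \<theta> :: "'i list \<Rightarrow> 'a::complex_inner \<Rightarrow> 'b::chilbert"
  assumes \<theta>: "\<And>\<alpha>. length \<alpha> \<le> m \<Longrightarrow> bounded_clinear (\<theta> \<alpha>)" and sb: "symbol_bounded m \<theta>"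
  shows "(\<lambda>\<alpha>. word_op right_creation \<alpha> (ampl (\<theta> \<alpha>) q)) summable_on {\<alpha>. length \<alpha> \<le> m}"
proof (rule summable_on_words_le)
  let ?t = "\<lambda>\<alpha>. word_op right_creation \<alpha> (ampl (\<theta> \<alpha>) q)"
  obtain K where K: "\<And>F h. finite F \<Longrightarrow> F \<subseteq> {\<alpha>. length \<alpha> \<le> m} \<Longrightarrow> (\<Sum>\<alpha>\<in>F. (norm (\<theta> \<alpha> h))\<^sup>2) \<le> (norm h)\<^sup>2 * K"
    using symbol_bounded_sum[OF sb] by blast
  fix p assume "p \<le> m"
  show "?t summable_on {\<alpha>. length \<alpha> = p}"
  proof (rule orthogonal_summable)
    show "pairwise (\<lambda>\<alpha> \<beta>. orthogonal (?t \<alpha>) (?t \<beta>)) {\<alpha>. length \<alpha> = p}"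
      unfolding pairwise_def
      by (auto intro!: orthogonal_disjoint_support simp: component_word_op_right)
    show "(\<lambda>\<alpha>. (norm (?t \<alpha>))\<^sup>2) summable_on {\<alpha>. length \<alpha> = p}"
    proof (rule nonneg_bdd_above_summable_on)
      show "bdd_above (sum (\<lambda>\<alpha>. (norm (?t \<alpha>))\<^sup>2) ` {F. F \<subseteq> {\<alpha>. length \<alpha> = p} \<and> finite F})"
      proof (rule bdd_aboveI2[where M = "(norm q)\<^sup>2 * K"])
        fix F assume "F \<in> {F. F \<subseteq> {\<alpha> :: 'i list. length \<alpha> = p} \<and> finite F}"
        then have F: "finite F" "F \<subseteq> {\<alpha>. length \<alpha> \<le> m}" using \<open>p \<le> m\<close> by auto
        have comp: "component (ampl (\<theta> \<alpha>) q) w = \<theta> \<alpha> (component q w)" if "\<alpha> \<in> F" for \<alpha> w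
          using that F \<theta> by (intro component_ampl) auto
        have s: "(\<lambda>w. (norm (\<theta> \<alpha> (component q w)))\<^sup>2) summable_on UNIV" if "\<alpha> \<in> F" for \<alpha>
          using component_summable[of "ampl (\<theta> \<alpha>) q"] by (simp add: comp[OF that])
        have sum_summable: "(\<lambda>w. \<Sum>\<alpha>\<in>F. (norm (\<theta> \<alpha> (component q w)))\<^sup>2) summable_on UNIV"
          using has_sum_sum[OF has_sum_infsum[OF s]] by (rule has_sum_imp_summable)
        have "(\<Sum>\<alpha>\<in>F. (norm (?t \<alpha>))\<^sup>2) = (\<Sum>\<alpha>\<in>F. \<Sum>\<^sub>\<infinity>w. (norm (\<theta> \<alpha> (component q w)))\<^sup>2)"
          by (intro sum.cong) (auto simp: norm_word_op_right norm_ell2_sq comp)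
        also have "\<dots> = (\<Sum>\<^sub>\<infinity>w. \<Sum>\<alpha>\<in>F. (norm (\<theta> \<alpha> (component q w)))\<^sup>2)"
          using s by (intro infsumI[symmetric] has_sum_sum has_sum_infsum) auto
        also have "\<dots> \<le> (\<Sum>\<^sub>\<infinity>w. (norm (component q w))\<^sup>2 * K)"
          by (intro infsum_mono sum_summable K[OF F] summable_on_cmult_left component_summable)
        also have "\<dots> = (norm q)\<^sup>2 * K"
          unfolding norm_ell2_sq by (intro infsum_cmult_left component_summable)
        finally show "(\<Sum>\<alpha>\<in>F. (norm (?t \<alpha>))\<^sup>2) \<le> (norm q)\<^sup>2 * K" .
      qed
    qed simp
  qed
qed

text \<open>The words that contribute are the reversed suffixes of \<gamma>. They all have length at
  most \<open>m\<close>, so the cut-off in \<Theta> loses nothing at this \<gamma>.\<close>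

lemma component_Theta_op:
  fixes \<theta> :: "'i list \<Rightarrow> 'a::complex_inner \<Rightarrow> 'b::chilbert"
  assumes \<theta>: "\<And>\<alpha>. length \<alpha> \<le> m \<Longrightarrow> bounded_clinear (\<theta> \<alpha>)" and sb: "symbol_bounded m \<theta>"
    and \<gamma>: "length \<gamma> \<le> m"
  shows "component (Theta_op m \<theta> q) \<gamma> = conv (\<lambda>\<beta>. \<theta> (rev \<beta>)) q \<gamma>"
proof -
  let ?t = "\<lambda>\<alpha>. word_op right_creation \<alpha> (ampl (\<theta> \<alpha>) q)"
  let ?B = "(\<lambda>p. rev (drop p \<gamma>)) ` {..length \<gamma>}"
  have inj: "inj_on (\<lambda>p. rev (drop p \<gamma>)) {..length \<gamma>}"
    by (rule inj_on_inverseI[where g = "\<lambda>\<alpha>. length \<gamma> - length \<alpha>"]) auto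
  have "((\<lambda>\<alpha>. component (?t \<alpha>) \<gamma>) has_sum component (Theta_op m \<theta> q) \<gamma>) {\<alpha>. length \<alpha> \<le> m}"
    unfolding Theta_op_def using \<theta> by (intro component_has_sum has_sum_infsum Theta_op_summable sb) auto
  then have "component (Theta_op m \<theta> q) \<gamma> = (\<Sum>\<alpha>\<in>?B. component (?t \<alpha>) \<gamma>)"
  proof (rule has_sum_finite_support)
    fix \<alpha> assume "\<alpha> \<in> {\<alpha>. length \<alpha> \<le> m} - ?B"
    then have "drop (length \<gamma> - length \<alpha>) \<gamma> \<noteq> rev \<alpha>"
      by (metis DiffD2 atMost_iff diff_le_self image_eqI rev_rev_ident)
    then show "component (?t \<alpha>) \<gamma> = 0" by (simp add: component_word_op_right)
  qed (use \<gamma> in auto)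
  also have "\<dots> = (\<Sum>p\<le>length \<gamma>. component (?t (rev (drop p \<gamma>))) \<gamma>)"
    by (simp add: sum.reindex[OF inj])
  also have "\<dots> = conv (\<lambda>\<beta>. \<theta> (rev \<beta>)) q \<gamma>"
    unfolding conv_def using \<gamma> by (intro sum.cong) (auto simp: component_word_op_right component_ampl \<theta>)
  finally show ?thesis .
qed

section \<open>Truncation, backward shift and norms of restrictions\<close>

lift_definition trunc :: "nat \<Rightarrow> ('i, 'a::real_inner) fock_tensor \<Rightarrow> ('i, 'a) fock_tensor"
  is "\<lambda>k q \<alpha>. if length \<alpha> \<le> k then q \<alpha> else 0"
proof -
  fix k and q :: "'i list \<Rightarrow> 'a"
  assume "(\<lambda>\<alpha>. (norm (q \<alpha>))\<^sup>2) summable_on UNIV"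
  then show "(\<lambda>\<alpha>. (norm (if length \<alpha> \<le> k then q \<alpha> else 0))\<^sup>2) summable_on UNIV"
    by (rule summable_on_le) auto
qed

text \<open>The adjoint of \<open>left_creation i\<close>, in coordinates.\<close>

lift_definition shift :: "'i \<Rightarrow> ('i, 'a::real_inner) fock_tensor \<Rightarrow> ('i, 'a) fock_tensor"
  is "\<lambda>i q \<alpha>. q (i # \<alpha>)"
proof -
  fix i and q :: "'i list \<Rightarrow> 'a"
  assume "(\<lambda>\<alpha>. (norm (q \<alpha>))\<^sup>2) summable_on UNIV"
  then have "(\<lambda>\<alpha>. (norm (q \<alpha>))\<^sup>2) summable_on range (Cons i)"
    by (rule summable_on_subset_banach) simp
  then show "(\<lambda>\<alpha>. (norm (q (i # \<alpha>)))\<^sup>2) summable_on UNIV"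
    by (subst (asm) summable_on_reindex) (auto simp: inj_on_def o_def)
qed

lemma trunc_in_polys: "trunc k q \<in> polys k"
  by (simp add: polys_def trunc.rep_eq)

lemma trunc_polys: "q \<in> polys k \<Longrightarrow> trunc k q = q"
  by (rule ell2_eqI) (auto simp: polys_def trunc.rep_eq)

lemma norm_trunc_le: "norm (trunc k q) \<le> norm q"
  by (rule ell2_norm_le) (simp add: trunc.rep_eq)

lemma trunc_add: "trunc k (x + y) = trunc k x + trunc k y"
  and trunc_scaleC: "trunc k (c *\<^sub>C z) = c *\<^sub>C trunc k z"
  by (rule ell2_eqI, simp add: trunc.rep_eq)+

text \<open>The residual of the truncation lives on words longer than \<open>m\<close>. Uniqueness
  follows by testing against \<open>basis_vec w \<otimes> h\<close> for each \<open>w\<close> of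
  length at most \<open>m\<close>.\<close>

lemma orth_proj_polys:
  fixes x :: "('i, 'a::complex_inner) fock_tensor"
  shows "orth_proj (polys m) x = trunc m x"
  unfolding orth_proj_def
proof (rule the_equality)
  have "cinner (component (x - trunc m x) w) (component z w) = 0" if "z \<in> polys m" for z w
    using that by (cases "length w \<le> m") (auto simp: polys_def trunc.rep_eq)
  then have "\<forall>z\<in>polys m. cinner (x - trunc m x) z = 0"
    by (simp add: cinner_ell2_def)
  then show "trunc m x \<in> polys m \<and> (\<forall>z\<in>polys m. cinner (x - trunc m x) z = 0)"
    by (simp add: trunc_in_polys)
next
  fix y assume y: "y \<in> polys m \<and> (\<forall>z\<in>polys m. cinner (x - y) z = 0)"
  show "y = trunc m x"
  proof (rule ell2_eqI)
    fix w
    show "component y w = component (trunc m x) w"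
    proof (cases "length w \<le> m")
      case True
      have "cinner (component (x - y) w) h = 0" for h
      proof -
        have "basis_vec w \<otimes> h \<in> polys m" using True by (auto simp: polys_def component_basis_tens)
        then show ?thesis using y cinner_basis_tens[of "x - y" w h] by simp
      qed
      then have "component (x - y) w = 0" by (metis cinner_extensionality cinner_zero_left)
      then show ?thesis using True by (simp add: trunc.rep_eq)
    next
      case False
      then show ?thesis using y by (simp add: polys_def trunc.rep_eq)
    qed
  qed
qed

text \<open>Rescaling to the unit ball. Homogeneity is asked for on \<open>V\<close> alone because
  \<open>mult_op\<close> is controlled only on polynomials.\<close>

lemma norm_on_le_one_iff:
  fixes T :: "'v::real_normed_vector \<Rightarrow> 'w::real_normed_vector"
  assumes V: "\<And>r q. q \<in> V \<Longrightarrow> r *\<^sub>R q \<in> V"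
    and T: "\<And>r q. q \<in> V \<Longrightarrow> T (r *\<^sub>R q) = r *\<^sub>R T q"
  shows "norm_on V T \<le> 1 \<longleftrightarrow> (\<forall>q\<in>V. norm (T q) \<le> norm q)"
proof
  assume le: "norm_on V T \<le> 1"
  have unit: "norm (T q) \<le> 1" if "q \<in> V" "norm q \<le> 1" for q
  proof -
    have "ennreal (norm (T q)) \<le> norm_on V T"
      unfolding norm_on_def using that by (intro SUP_upper) auto
    also note le
    finally show ?thesis by simp
  qed
  show "\<forall>q\<in>V. norm (T q) \<le> norm q"
  proof
    fix q assume q: "q \<in> V"
    show "norm (T q) \<le> norm q"
    proof (cases "q = 0")
      case True
      then show ?thesis using T[OF q, of 0] by simp
    next
      case False
      then have "norm (T ((1 / norm q) *\<^sub>R q)) \<le> 1" using q by (intro unit V) auto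
      then show ?thesis using False by (simp add: T[OF q] field_simps)
    qed
  qed
next
  assume "\<forall>q\<in>V. norm (T q) \<le> norm q"
  then show "norm_on V T \<le> 1"
    unfolding norm_on_def by (intro SUP_least) (auto intro: order_trans)
qed

section \<open>Contractive symbols\<close>

lemma conv_cong:
  "(\<And>\<beta>. length \<beta> \<le> length \<gamma> \<Longrightarrow> c \<beta> = c' \<beta>) \<Longrightarrow> conv c q \<gamma> = conv c' q \<gamma>"
  unfolding conv_def by (intro sum.cong) auto

lemma conv_trunc: "length \<gamma> \<le> k \<Longrightarrow> conv c (trunc k q) \<gamma> = conv c q \<gamma>"
  unfolding conv_def by (intro sum.cong) (auto simp: trunc.rep_eq)

lemma conv_add:
  "(\<And>\<beta>. bounded_clinear (c \<beta>)) \<Longrightarrow> conv c (x + y) \<gamma> = conv c x \<gamma> + conv c y \<gamma>"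
  by (simp add: conv_def bounded_clinear_simps sum.distrib)

lemma scaleC_sum: "z *\<^sub>C (\<Sum>i\<in>I. f i) = (\<Sum>i\<in>I. z *\<^sub>C (f i :: 'a::complex_inner))"
  by (induction I rule: infinite_finite_induct) (auto simp: scaleC_add_right)

lemma conv_scaleC:
  "(\<And>\<beta>. bounded_clinear (c \<beta>)) \<Longrightarrow> conv c (z *\<^sub>C x) \<gamma> = z *\<^sub>C conv c x \<gamma>"
  by (simp add: conv_def bounded_clinear_simps scaleC_sum)

lemma conv_scaleR:
  "(\<And>\<beta>. bounded_clinear (c \<beta>)) \<Longrightarrow> conv c (r *\<^sub>R x) \<gamma> = r *\<^sub>R conv c x \<gamma>"
  by (simp add: conv_def bounded_clinear_simps scaleR_sum_right)

text \<open>The coordinate form of \<open>M_phi (1 \<otimes> h) = phi h\<close>: constants recover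
  the coefficients.\<close>

lemma conv_basis_tens:
  assumes "\<And>\<beta>. bounded_clinear (c \<beta>)"
  shows "conv c (basis_vec [] \<otimes> h) \<gamma> = c \<gamma> h"
proof -
  have "conv c (basis_vec [] \<otimes> h) \<gamma> = (\<Sum>p\<in>{0}. c (drop p \<gamma>) (component (basis_vec [] \<otimes> h) (take p \<gamma>)))"
    unfolding conv_def
    by (rule sum.mono_neutral_right) (auto simp: component_basis_tens bounded_clinear_simps[OF assms])
  then show ?thesis by (simp add: component_basis_tens)
qed

text \<open>The factorization with empty prefix contributes nothing, and the others are those of
  \<gamma> with \<open>i\<close> put in front of the prefix.\<close>

lemma conv_shift:
  assumes "\<And>\<beta>. bounded_clinear (c \<beta>)" "component q [] = 0"
  shows "conv c q (i # \<gamma>) = conv c (shift i q) \<gamma>"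
  using assms
  by (simp add: conv_def sum.atMost_Suc_shift shift.rep_eq bounded_clinear_simps del: sum.atMost_Suc)

text \<open>Distinct first letters give disjoint sets of words, so the shifts account for disjoint
  parts of the norm of \<open>q\<close>.\<close>

lemma sum_norm_shift_le:
  assumes "finite I"
  shows "(\<Sum>i\<in>I. (norm (shift i q))\<^sup>2) \<le> (norm q)\<^sup>2"
proof -
  let ?n = "\<lambda>\<alpha>. (norm (component q \<alpha>))\<^sup>2"
  have "(\<Sum>i\<in>I. (norm (shift i q))\<^sup>2) = (\<Sum>i\<in>I. infsum ?n (range (Cons i)))"
    by (intro sum.cong) (auto simp: norm_ell2_sq shift.rep_eq infsum_reindex inj_on_def o_def)
  also have "\<dots> = infsum ?n (\<Union>i\<in>I. range (Cons i))"
    using assms by (intro sum_infsum component_summable) auto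
  also have "\<dots> \<le> (norm q)\<^sup>2"
    unfolding norm_ell2_sq by (intro infsum_mono2 component_summable) auto
  finally show ?thesis .
qed

text \<open>\<open>contr c j k\<close> says that $\|P_{\mathcal P_j \otimes K'} M_\phi|_{\mathcal P_k \otimes K}\| \le 1$
  for the symbol $\phi$ with components \<^term>\<open>c\<close>.\<close>

definition contr :: "('i list \<Rightarrow> 'a::complex_inner \<Rightarrow> 'b::complex_inner) \<Rightarrow> nat \<Rightarrow> nat \<Rightarrow> bool" where
  "contr c j k \<longleftrightarrow> (\<forall>q\<in>polys k. \<forall>F. finite F \<longrightarrow> F \<subseteq> {\<gamma>. length \<gamma> \<le> j} \<longrightarrow>
     (\<Sum>\<gamma>\<in>F. (norm (conv c q \<gamma>))\<^sup>2) \<le> (norm q)\<^sup>2)"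

section \<open>Contractivity of compressions\<close>

lemma contrD:
  "contr c j k \<Longrightarrow> q \<in> polys k \<Longrightarrow> finite F \<Longrightarrow> F \<subseteq> {\<gamma>. length \<gamma> \<le> j} \<Longrightarrow>
    (\<Sum>\<gamma>\<in>F. (norm (conv c q \<gamma>))\<^sup>2) \<le> (norm q)\<^sup>2"
  by (auto simp: contr_def)

lemma contr_cong:
  assumes "\<And>\<beta>. length \<beta> \<le> j \<Longrightarrow> c \<beta> = c' \<beta>"
  shows "contr c j k \<longleftrightarrow> contr c' j k"
proof -
  have "conv c q \<gamma> = conv c' q \<gamma>" if "length \<gamma> \<le> j" for q \<gamma>
    using that assms by (intro conv_cong) auto
  then have "(\<Sum>\<gamma>\<in>F. (norm (conv c q \<gamma>))\<^sup>2) = (\<Sum>\<gamma>\<in>F. (norm (conv c' q \<gamma>))\<^sup>2)"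
    if "F \<subseteq> {\<gamma>. length \<gamma> \<le> j}" for F q
    using that by (intro sum.cong) auto
  then show ?thesis unfolding contr_def by metis
qed

lemma contr_mono:
  fixes c :: "'i list \<Rightarrow> 'a::complex_inner \<Rightarrow> 'b::complex_inner"
  assumes "contr c j k" "j' \<le> j" "k' \<le> k"
  shows "contr c j' k'"
  unfolding contr_def
proof (intro ballI allI impI)
  fix q :: "('i, 'a) fock_tensor" and F :: "'i list set"
  assume "q \<in> polys k'" "finite F" "F \<subseteq> {\<gamma>. length \<gamma> \<le> j'}"
  then show "(\<Sum>\<gamma>\<in>F. (norm (conv c q \<gamma>))\<^sup>2) \<le> (norm q)\<^sup>2"
    using assms by (intro contrD[OF assms(1)]) (auto simp: polys_def)
qed

text \<open>Output words of length at most \<open>j\<close> see only the components of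
  \<open>q\<close> of length at most \<open>j\<close>. This is the source of the case distinction
  between \<open>k \<le> m\<close> and \<open>k > m\<close>.\<close>

lemma contr_min:
  fixes c :: "'i list \<Rightarrow> 'a::complex_inner \<Rightarrow> 'b::complex_inner"
  shows "contr c j k \<longleftrightarrow> contr c j (min j k)"
proof (cases "k \<le> j")
  case False
  then have k: "j \<le> k" by simp
  have "contr c j k \<longleftrightarrow> contr c j j"
  proof
    show "contr c j j" if "contr c j k"
      using contr_mono[OF that _ k] by simp
  next
    assume c: "contr c j j"
    show "contr c j k" unfolding contr_def
    proof (intro ballI allI impI)
      fix q :: "('i, 'a) fock_tensor" and F :: "'i list set"
      assume F: "finite F" "F \<subseteq> {\<gamma>. length \<gamma> \<le> j}"
      have "(\<Sum>\<gamma>\<in>F. (norm (conv c q \<gamma>))\<^sup>2) = (\<Sum>\<gamma>\<in>F. (norm (conv c (trunc j q) \<gamma>))\<^sup>2)"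
        using F by (intro sum.cong) (auto simp: conv_trunc)
      also have "\<dots> \<le> (norm (trunc j q))\<^sup>2" by (intro contrD[OF c trunc_in_polys] F)
      also have "\<dots> \<le> (norm q)\<^sup>2" by (intro power_mono norm_trunc_le) simp
      finally show "(\<Sum>\<gamma>\<in>F. (norm (conv c q \<gamma>))\<^sup>2) \<le> (norm q)\<^sup>2" .
    qed
  qed
  then show ?thesis using k by (simp add: min_def)
qed (simp add: min_def)

text \<open>The gain of one degree. Words are grouped by first letter, and stripping it leads back
  to degree \<open>j\<close> for the shifted polynomial. Coefficients of length \<open>Suc j\<close>
  meet only the constant term, which is zero.\<close>

lemma contr_shift:
  assumes c: "\<And>\<beta>. bounded_clinear (c \<beta>)" and contr: "contr c j k"
    and q: "q \<in> polys k" "component q [] = 0" and F: "finite F" "F \<subseteq> {\<gamma>. length \<gamma> \<le> Suc j}"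
  shows "(\<Sum>\<gamma>\<in>F. (norm (conv c q \<gamma>))\<^sup>2) \<le> (norm q)\<^sup>2"
proof -
  let ?n = "\<lambda>\<gamma>. (norm (conv c q \<gamma>))\<^sup>2" and ?F = "F - {[]}"
  have "conv c q [] = 0" by (simp add: conv_def q bounded_clinear_simps[OF c])
  then have "sum ?n F = sum ?n ?F" using F by (intro sum.mono_neutral_right) auto
  also have "\<dots> = (\<Sum>i\<in>hd ` ?F. sum ?n {\<gamma> \<in> ?F. hd \<gamma> = i})"
    using F by (intro sum.group[symmetric]) auto
  also have "\<dots> \<le> (\<Sum>i\<in>hd ` ?F. (norm (shift i q))\<^sup>2)"
  proof (rule sum_mono)
    fix i
    let ?G = "tl ` {\<gamma> \<in> ?F. hd \<gamma> = i}"
    have eq: "{\<gamma> \<in> ?F. hd \<gamma> = i} = Cons i ` ?G" by (force simp: image_image)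
    have "sum ?n {\<gamma> \<in> ?F. hd \<gamma> = i} = (\<Sum>\<gamma>\<in>?G. (norm (conv c (shift i q) \<gamma>))\<^sup>2)"
      by (subst eq, subst sum.reindex) (auto simp: inj_on_def conv_shift[OF c q(2)])
    also have "\<dots> \<le> (norm (shift i q))\<^sup>2"
      using F q by (intro contrD[OF contr]) (auto simp: polys_def shift.rep_eq)
    finally show "sum ?n {\<gamma> \<in> ?F. hd \<gamma> = i} \<le> (norm (shift i q))\<^sup>2" .
  qed
  also have "\<dots> \<le> (norm q)\<^sup>2" using F by (intro sum_norm_shift_le) simp
  finally show ?thesis .
qed

section \<open>Extension by one degree and passage to all degrees\<close>

lemma one_step_extension:
  fixes c :: "'i list \<Rightarrow> 'a::complex_inner \<Rightarrow> 'b::chilbert"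
  assumes c: "\<And>\<beta>. bounded_clinear (c \<beta>)" and contr: "contr c j k"
  shows "\<exists>c'. (\<forall>\<beta>. bounded_clinear (c' \<beta>)) \<and> contr c' (Suc j) k \<and> (\<forall>\<beta>. length \<beta> \<le> j \<longrightarrow> c' \<beta> = c \<beta>)"
proof -
  \<comment> \<open>\<open>parrott_extension\<close> works on a whole space, so \<open>T\<close> is
    defined on all \<open>q\<close> by truncating first.\<close>
  define T where "T q = Abs_ell2 (\<lambda>\<gamma>. if length \<gamma> \<le> j then conv c (trunc k q) \<gamma> else 0)" for q
  \<comment> \<open>Square-summability of this family is established on \<open>W\<close> alone, so
    \<open>Abs_ell2\<close> has its intended meaning there.\<close>
  define D where "D q = Abs_ell2 (\<lambda>\<gamma>. if length \<gamma> = Suc j then conv c (trunc k q) \<gamma> else 0)" for q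
  define W :: "('i, 'a) fock_tensor set" where "W = {q. component q [] = 0}"
  have restr: "(\<Sum>\<gamma>\<in>F. (norm (if P \<gamma> then f \<gamma> else (0::'b)))\<^sup>2) = (\<Sum>\<gamma>\<in>{\<gamma>\<in>F. P \<gamma>}. (norm (f \<gamma>))\<^sup>2)"
    if "finite F" for F :: "'i list set" and P f
    using that by (intro sum.mono_neutral_cong_right) auto
  have Tq: "component (T q) \<gamma> = (if length \<gamma> \<le> j then conv c (trunc k q) \<gamma> else 0)" for q \<gamma>
    unfolding T_def
    by (rule component_Abs_ell2[where r = "(norm (trunc k q))\<^sup>2"])
      (auto simp: restr intro!: contrD[OF contr trunc_in_polys])
  have W_trunc: "component (trunc k q) [] = 0" if "q \<in> W" for q
    using that by (simp add: W_def trunc.rep_eq)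
  have Dq: "component (D q) \<gamma> = (if length \<gamma> = Suc j then conv c (trunc k q) \<gamma> else 0)" if "q \<in> W" for q \<gamma>
    unfolding D_def
    by (rule component_Abs_ell2[where r = "(norm (trunc k q))\<^sup>2"])
      (auto simp: restr intro!: contr_shift[OF c contr trunc_in_polys W_trunc[OF that]])
  have T_le: "norm (T q) \<le> norm q" for q
  proof -
    have "(norm (T q))\<^sup>2 \<le> (norm (trunc k q))\<^sup>2"
      unfolding ell2_norm_sq_le_iff by (auto simp: Tq restr intro!: contrD[OF contr trunc_in_polys])
    then show ?thesis using norm_trunc_le[of k q] by simp
  qed
  have T: "bounded_clinear T"
    by (rule bounded_clinearI[where K = 1])
      (auto intro!: ell2_eqI simp: Tq T_le trunc_add trunc_scaleC conv_add conv_scaleC c)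
  have TD_le: "(norm (T q))\<^sup>2 + (norm (D q))\<^sup>2 \<le> (norm q)\<^sup>2" if "q \<in> W" for q
  proof -
    \<comment> \<open>\<open>T q\<close> and \<open>D q\<close> live on different word lengths, and
      their sum is the compression to degree at most \<open>Suc j\<close>, to which
      \<open>contr_shift\<close> applies.\<close>
    have "orthogonal (T q) (D q)"
      by (rule orthogonal_disjoint_support) (simp add: Tq Dq that)
    then have "(norm (T q))\<^sup>2 + (norm (D q))\<^sup>2 = (norm (T q + D q))\<^sup>2"
      by (simp add: norm_add_Pythagorean)
    also have "\<dots> \<le> (norm (trunc k q))\<^sup>2"
    proof -
      have "component (T q + D q) \<gamma> = (if length \<gamma> \<le> Suc j then conv c (trunc k q) \<gamma> else 0)" for \<gamma>
        by (auto simp: Tq Dq that)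
      then show ?thesis
        unfolding ell2_norm_sq_le_iff
        by (auto simp: restr simp del: plus_ell2.rep_eq
          intro!: contr_shift[OF c contr trunc_in_polys W_trunc[OF that]])
    qed
    also have "\<dots> \<le> (norm q)\<^sup>2" by (intro power_mono norm_trunc_le) simp
    finally show ?thesis .
  qed
  have W: "0 \<in> W" "\<And>x y. x \<in> W \<Longrightarrow> y \<in> W \<Longrightarrow> x + y \<in> W" "\<And>z x. x \<in> W \<Longrightarrow> z *\<^sub>C x \<in> W"
    by (auto simp: W_def)
  have D_add: "D (x + y) = D x + D y" if "x \<in> W" "y \<in> W" for x y
    using that W(2)[OF that] by (auto intro!: ell2_eqI simp: Dq trunc_add conv_add c)
  have D_scale: "D (z *\<^sub>C x) = z *\<^sub>C D x" if "x \<in> W" for x z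
    using that W(3)[OF that] by (auto intro!: ell2_eqI simp: Dq trunc_scaleC conv_scaleC c)
  obtain D' where D': "bounded_clinear D'" and DD': "\<And>x. x \<in> W \<Longrightarrow> D' x = D x"
    and D'_le: "\<And>v. (norm (T v))\<^sup>2 + (norm (D' v))\<^sup>2 \<le> (norm v)\<^sup>2"
    by (rule parrott_extension[OF T T_le W D_add D_scale TD_le]) blast+
  define c' where "c' \<beta> = (if length \<beta> = Suc j then \<lambda>h. component (D' (basis_vec [] \<otimes> h)) \<beta> else c \<beta>)" for \<beta>
  have "bounded_clinear (c' \<beta>)" for \<beta>
    unfolding c'_def using c
    by (auto intro!: bounded_clinear_compose[OF bounded_clinear_component]
      bounded_clinear_compose[OF D'] bounded_clinear_basis_tens)
  moreover have "contr c' (Suc j) k"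
    unfolding contr_def
  proof (intro ballI allI impI)
    fix q :: "('i, 'a) fock_tensor" and F
    assume q: "q \<in> polys k" and F: "finite F" "F \<subseteq> {\<gamma> :: 'i list. length \<gamma> \<le> Suc j}"
    \<comment> \<open>Removing the constant term leaves an element of \<open>W\<close>, where
      \<open>D'\<close> agrees with \<open>D\<close>; on the constant term \<open>D'\<close> agrees
      with the new coefficients by definition.\<close>
    let ?r = "q - basis_vec [] \<otimes> component q []"
    have r: "?r \<in> W" by (simp add: W_def component_basis_tens)
    have rk: "trunc k ?r = ?r" using q by (intro trunc_polys) (auto simp: polys_def component_basis_tens)
    have low: "conv c' q \<gamma> = component (T q) \<gamma>" if "length \<gamma> \<le> j" for \<gamma>
      using that q by (simp add: Tq trunc_polys) (intro conv_cong, auto simp: c'_def)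
    have high: "conv c' q \<gamma> = component (D' q) \<gamma>" if \<gamma>: "length \<gamma> = Suc j" for \<gamma>
    proof -
      have "conv c' q \<gamma> = c' \<gamma> (component q []) + (\<Sum>p\<le>j. c' (drop (Suc p) \<gamma>) (component q (take (Suc p) \<gamma>)))"
        unfolding conv_def \<gamma> by (subst sum.atMost_Suc_shift) simp
      \<comment> \<open>The remaining suffixes have length at most \<open>j\<close>, where
        \<open>c'\<close> and \<open>c\<close> agree, and the empty-prefix term for
        \<open>?r\<close> is zero.\<close>
      also have "(\<Sum>p\<le>j. c' (drop (Suc p) \<gamma>) (component q (take (Suc p) \<gamma>))) = conv c ?r \<gamma>"
        unfolding conv_def \<gamma> sum.atMost_Suc_shift using \<gamma>
        by (auto simp: component_basis_tens c'_def bounded_clinear_simps[OF c] intro!: sum.cong)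
      also have "\<dots> = component (D' ?r) \<gamma>"
        by (simp add: DD'[OF r] Dq[OF r] rk \<gamma> del: minus_ell2.rep_eq)
      also have "c' \<gamma> (component q []) = component (D' (basis_vec [] \<otimes> component q [])) \<gamma>"
        by (simp add: c'_def \<gamma>)
      finally show ?thesis by (simp add: bounded_clinear_simps[OF D'])
    qed
    have split: "F = {\<gamma>\<in>F. length \<gamma> \<le> j} \<union> {\<gamma>\<in>F. length \<gamma> = Suc j}" using F by auto
    have "(\<Sum>\<gamma>\<in>F. (norm (conv c' q \<gamma>))\<^sup>2) =
        (\<Sum>\<gamma>\<in>{\<gamma>\<in>F. length \<gamma> \<le> j}. (norm (component (T q) \<gamma>))\<^sup>2)
      + (\<Sum>\<gamma>\<in>{\<gamma>\<in>F. length \<gamma> = Suc j}. (norm (component (D' q) \<gamma>))\<^sup>2)"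
      using F(1) by (subst split, subst sum.union_disjoint) (auto simp: low high)
    also have "\<dots> \<le> (norm (T q))\<^sup>2 + (norm (D' q))\<^sup>2"
      using F(1) by (intro add_mono sum_component_le) auto
    also note D'_le
    finally show "(\<Sum>\<gamma>\<in>F. (norm (conv c' q \<gamma>))\<^sup>2) \<le> (norm q)\<^sup>2" .
  qed
  moreover have "\<forall>\<beta>. length \<beta> \<le> j \<longrightarrow> c' \<beta> = c \<beta>" by (auto simp: c'_def)
  ultimately show ?thesis by blast
qed

text \<open>Dependent choice iterates the one-step extension. Each coefficient is final once its
  length has been reached, so the stages have a limit.\<close>

lemma full_extension:
  fixes c :: "'i list \<Rightarrow> 'a::complex_inner \<Rightarrow> 'b::chilbert"
  assumes c: "\<And>\<beta>. bounded_clinear (c \<beta>)" and contr: "contr c m k"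
  obtains c' where "\<And>\<beta>. bounded_clinear (c' \<beta>)" "\<And>j. contr c' j k" "\<And>\<beta>. length \<beta> \<le> m \<Longrightarrow> c' \<beta> = c \<beta>"
proof -
  have "\<exists>C. \<forall>n. ((\<forall>\<beta>. bounded_clinear (C n \<beta>)) \<and> contr (C n) (m + n) k \<and> (\<forall>\<beta>. length \<beta> \<le> m \<longrightarrow> C n \<beta> = c \<beta>))
      \<and> (\<forall>\<beta>. length \<beta> \<le> m + n \<longrightarrow> C (Suc n) \<beta> = C n \<beta>)"
  proof (rule dependent_nat_choice)
    show "\<exists>x. (\<forall>\<beta>. bounded_clinear (x \<beta>)) \<and> contr x (m + 0) k \<and> (\<forall>\<beta>. length \<beta> \<le> m \<longrightarrow> x \<beta> = c \<beta>)"
      using assms by auto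
  next
    fix x n
    assume "(\<forall>\<beta>. bounded_clinear (x \<beta>)) \<and> contr x (m + n) k \<and> (\<forall>\<beta>. length \<beta> \<le> m \<longrightarrow> x \<beta> = c \<beta>)"
    then show "\<exists>y. ((\<forall>\<beta>. bounded_clinear (y \<beta>)) \<and> contr y (m + Suc n) k \<and> (\<forall>\<beta>. length \<beta> \<le> m \<longrightarrow> y \<beta> = c \<beta>))
        \<and> (\<forall>\<beta>. length \<beta> \<le> m + n \<longrightarrow> y \<beta> = x \<beta>)"
      using one_step_extension[of x "m + n" k] by (metis add_Suc_right trans_le_add1)
  qed
  then obtain C where C: "\<And>n \<beta>. bounded_clinear (C n \<beta>)" "\<And>n. contr (C n) (m + n) k"
    "\<And>n \<beta>. length \<beta> \<le> m \<Longrightarrow> C n \<beta> = c \<beta>" and step: "\<And>n \<beta>. length \<beta> \<le> m + n \<Longrightarrow> C (Suc n) \<beta> = C n \<beta>"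
    by blast
  have mono: "C (n + d) \<beta> = C n \<beta>" if "length \<beta> \<le> m + n" for n d \<beta>
    using that by (induction d) (simp_all add: step)
  \<comment> \<open>Stage \<open>length \<beta>\<close> already covers degree
    \<open>m + length \<beta>\<close>, so the coefficient at \<beta> no longer changes.\<close>
  define c' where "c' \<beta> = C (length \<beta>) \<beta>" for \<beta>
  have c'_eq: "c' \<beta> = C n \<beta>" if "length \<beta> \<le> n" for n \<beta>
    using mono[of \<beta> "length \<beta>" "n - length \<beta>"] that by (simp add: c'_def)
  show ?thesis
  proof
    show "bounded_clinear (c' \<beta>)" for \<beta> by (simp add: c'_def C)
    show "c' \<beta> = c \<beta>" if "length \<beta> \<le> m" for \<beta> using that by (simp add: c'_def C)
    show "contr c' j k" for j
    proof -
      have "contr (C j) j k" using contr_mono[OF C(2)[of j]] by simp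
      then show ?thesis using contr_cong[of j c' "C j" k] c'_eq by blast
    qed
  qed
qed

section \<open>From operator norms to contractivity of coefficients\<close>

lemma norm_on_mult_op_iff:
  fixes \<phi> :: "'a::complex_inner \<Rightarrow> ('i, 'b::chilbert) fock_tensor"
  assumes \<phi>: "bounded_clinear \<phi>"
  shows "norm_on (polys k) (mult_op \<phi>) \<le> 1 \<longleftrightarrow> (\<forall>j. contr (\<lambda>\<beta> h. component (\<phi> h) \<beta>) j k)"
proof -
  let ?c = "\<lambda>\<beta> h. component (\<phi> h) \<beta>"
  have c: "bounded_clinear (?c \<beta>)" for \<beta>
    by (intro bounded_clinear_compose[OF bounded_clinear_component] \<phi>)
  have scale: "r *\<^sub>R q \<in> polys k" if "q \<in> polys k" for r and q :: "('i, 'a) fock_tensor"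
    using that by (simp add: polys_def)
  have "norm_on (polys k) (mult_op \<phi>) \<le> 1 \<longleftrightarrow> (\<forall>q\<in>polys k. norm (mult_op \<phi> q) \<le> norm q)"
    by (rule norm_on_le_one_iff)
      (auto intro!: ell2_eqI simp: scale component_mult_op[OF \<phi>, of _ k] conv_scaleR[OF c])
  also have "\<dots> \<longleftrightarrow> (\<forall>q\<in>polys k. (norm (mult_op \<phi> q))\<^sup>2 \<le> (norm q)\<^sup>2)" by simp
  also have "\<dots> \<longleftrightarrow> (\<forall>q\<in>polys k. \<forall>F. finite F \<longrightarrow> (\<Sum>\<gamma>\<in>F. (norm (conv ?c q \<gamma>))\<^sup>2) \<le> (norm q)\<^sup>2)"
    unfolding ell2_norm_sq_le_iff by (simp add: component_mult_op[OF \<phi>, of _ k])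
  also have "\<dots> \<longleftrightarrow> (\<forall>j. contr ?c j k)"
  proof
    assume r: "\<forall>j. contr ?c j k"
    show "\<forall>q\<in>polys k. \<forall>F. finite F \<longrightarrow> (\<Sum>\<gamma>\<in>F. (norm (conv ?c q \<gamma>))\<^sup>2) \<le> (norm q)\<^sup>2"
    proof (intro ballI allI impI)
      fix q :: "('i, 'a) fock_tensor" and F :: "'i list set" assume "q \<in> polys k" "finite F"
      then show "(\<Sum>\<gamma>\<in>F. (norm (conv ?c q \<gamma>))\<^sup>2) \<le> (norm q)\<^sup>2"
        \<comment> \<open>A finite set of words lies below some degree, so contractivity in every
          degree controls the whole norm.\<close>
        by (intro contrD[OF r[rule_format, of "Max (length ` F)"]]) auto
    qed
  qed (auto simp: contr_def)
  finally show ?thesis .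
qed

lemma norm_on_Theta_op_iff:
  fixes \<theta> :: "'i list \<Rightarrow> 'a::complex_inner \<Rightarrow> 'b::chilbert"
  assumes \<theta>: "\<And>\<alpha>. length \<alpha> \<le> m \<Longrightarrow> bounded_clinear (\<theta> \<alpha>)" and sb: "symbol_bounded m \<theta>"
  shows "norm_on (polys k) (\<lambda>q. orth_proj (polys m) (Theta_op m \<theta> q)) \<le> 1 \<longleftrightarrow> contr (\<lambda>\<beta>. \<theta> (rev \<beta>)) m k"
proof -
  \<comment> \<open>Boundedness of \<open>\<theta> \<alpha>\<close> is given up to length
    \<open>m\<close>, while the linearity rules for \<open>conv\<close> ask for it at every word;
    the padding by 0 is invisible in degree at most \<open>m\<close>.\<close>
  let ?c = "\<lambda>\<beta>. if length \<beta> \<le> m then \<theta> (rev \<beta>) else (\<lambda>_. 0)"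
  let ?P = "\<lambda>q. trunc m (Theta_op m \<theta> q)"
  have c: "bounded_clinear (?c \<beta>)" for \<beta> by (simp add: \<theta> bounded_clinear_0)
  have P: "component (?P q) \<gamma> = (if length \<gamma> \<le> m then conv ?c q \<gamma> else 0)" for q \<gamma>
    by (auto simp: trunc.rep_eq component_Theta_op[OF \<theta> sb] intro!: conv_cong)
  have scale: "r *\<^sub>R q \<in> polys k" if "q \<in> polys k" for r and q :: "('i, 'a) fock_tensor"
    using that by (simp add: polys_def)
  have "norm_on (polys k) (\<lambda>q. orth_proj (polys m) (Theta_op m \<theta> q)) \<le> 1 \<longleftrightarrow>
      (\<forall>q\<in>polys k. norm (?P q) \<le> norm q)"
    unfolding orth_proj_polys
    by (rule norm_on_le_one_iff) (auto intro!: ell2_eqI simp: scale P conv_scaleR[OF c])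
  also have "\<dots> \<longleftrightarrow> (\<forall>q\<in>polys k. (norm (?P q))\<^sup>2 \<le> (norm q)\<^sup>2)" by simp
  also have "\<dots> \<longleftrightarrow> contr ?c m k"
    unfolding contr_def
  proof (intro ball_cong refl iffI allI impI)
    fix q F
    assume "(norm (?P q))\<^sup>2 \<le> (norm q)\<^sup>2" "finite F" "F \<subseteq> {\<gamma> :: 'i list. length \<gamma> \<le> m}"
    moreover from this have "(\<Sum>\<gamma>\<in>F. (norm (conv ?c q \<gamma>))\<^sup>2) = (\<Sum>\<gamma>\<in>F. (norm (component (?P q) \<gamma>))\<^sup>2)"
      by (intro sum.cong) (auto simp: P)
    ultimately show "(\<Sum>\<gamma>\<in>F. (norm (conv ?c q \<gamma>))\<^sup>2) \<le> (norm q)\<^sup>2"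
      by (simp add: ell2_norm_sq_le_iff)
  next
    fix q
    assume r: "\<forall>F. finite F \<longrightarrow> F \<subseteq> {\<gamma>. length \<gamma> \<le> m} \<longrightarrow> (\<Sum>\<gamma>\<in>F. (norm (conv ?c q \<gamma>))\<^sup>2) \<le> (norm q)\<^sup>2"
    show "(norm (?P q))\<^sup>2 \<le> (norm q)\<^sup>2"
      unfolding ell2_norm_sq_le_iff
    proof (intro allI impI)
      fix F :: "'i list set" assume "finite F"
      then have "(\<Sum>\<gamma>\<in>F. (norm (component (?P q) \<gamma>))\<^sup>2) = (\<Sum>\<gamma>\<in>{\<gamma>\<in>F. length \<gamma> \<le> m}. (norm (conv ?c q \<gamma>))\<^sup>2)"
        by (intro sum.mono_neutral_cong_right) (auto simp: P)
      also have "\<dots> \<le> (norm q)\<^sup>2" using \<open>finite F\<close> by (intro r[rule_format]) auto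
      finally show "(\<Sum>\<gamma>\<in>F. (norm (component (?P q) \<gamma>))\<^sup>2) \<le> (norm q)\<^sup>2" .
    qed
  qed
  also have "\<dots> \<longleftrightarrow> contr (\<lambda>\<beta>. \<theta> (rev \<beta>)) m k" by (rule contr_cong) simp
  finally show ?thesis .
qed

theorem theorem3p4:
  fixes k m :: nat
    and \<theta> :: "'i::countable list \<Rightarrow> 'a::chilbert \<Rightarrow> 'b::chilbert"
  assumes "\<And>\<alpha>. length \<alpha> \<le> m \<Longrightarrow> bounded_clinear (\<theta> \<alpha>)"
    and "infinite (UNIV :: 'i set) \<Longrightarrow> symbol_bounded m \<theta>"
  shows "(\<exists>\<phi> :: 'a \<Rightarrow> ('i, 'b) fock_tensor. bounded_clinear \<phi> \<and>
            (\<forall>\<alpha>. length \<alpha> \<le> m \<longrightarrow> \<theta> \<alpha> = fcoeff \<phi> \<alpha>) \<and>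
            norm_on (polys k) (mult_op \<phi>) \<le> 1)
     \<longleftrightarrow> (if k \<le> m
          then norm_on (polys k) (\<lambda>q. orth_proj (polys m) (Theta_op m \<theta> q)) \<le> 1
          else norm_on (polys m) (\<lambda>q. orth_proj (polys m) (Theta_op m \<theta> q)) \<le> 1)"
    (is "?lhs \<longleftrightarrow> ?rhs")
proof -
  \<comment> \<open>The reversal matches \<open>fcoeff\<close>: the coefficient at \<alpha> is the
    component at \<open>rev \<alpha>\<close>.\<close>
  let ?c = "\<lambda>\<beta>. \<theta> (rev \<beta>)"
  have "symbol_bounded m \<theta>"
    using assms symbol_bounded_finite by blast
  then have "?rhs \<longleftrightarrow> (if k \<le> m then contr ?c m k else contr ?c m m)"
    using assms(1) by (simp add: norm_on_Theta_op_iff)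
  also have "\<dots> \<longleftrightarrow> contr ?c m k"
    using contr_min[of ?c m k] by (simp add: min_def)
  also have "\<dots> \<longleftrightarrow> ?lhs"
  proof
    assume "?lhs"
    then obtain \<phi> :: "'a \<Rightarrow> ('i, 'b) fock_tensor" where \<phi>: "bounded_clinear \<phi>"
      and co: "\<And>\<alpha>. length \<alpha> \<le> m \<Longrightarrow> \<theta> \<alpha> = fcoeff \<phi> \<alpha>" and n: "norm_on (polys k) (mult_op \<phi>) \<le> 1"
      by blast
    have "contr (\<lambda>\<beta> h. component (\<phi> h) \<beta>) m k"
      using n norm_on_mult_op_iff[OF \<phi>] by blast
    moreover have "\<theta> (rev \<beta>) = (\<lambda>h. component (\<phi> h) \<beta>)" if "length \<beta> \<le> m" for \<beta>
      using co[of "rev \<beta>"] that by (simp add: fcoeff_eq fun_eq_iff)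
    ultimately show "contr ?c m k"
      using contr_cong[of m ?c "\<lambda>\<beta> h. component (\<phi> h) \<beta>" k] by blast
  next
    assume contr: "contr ?c m k"
    define c0 where "c0 \<beta> = (if length \<beta> \<le> m then \<theta> (rev \<beta>) else (\<lambda>_. 0))" for \<beta>
    have "bounded_clinear (c0 \<beta>)" for \<beta> by (simp add: c0_def assms bounded_clinear_0)
    moreover have "contr c0 m k"
      using contr contr_cong[of m ?c c0 k] by (simp add: c0_def)
    ultimately obtain c where c: "\<And>\<beta>. bounded_clinear (c \<beta>)" and cj: "\<And>j. contr c j k"
      and cm: "\<And>\<beta>. length \<beta> \<le> m \<Longrightarrow> c \<beta> = c0 \<beta>"
      using full_extension[of c0 m k] by metis
    define \<phi> where "\<phi> h = Abs_ell2 (\<lambda>\<beta>. c \<beta> h)" for h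
    \<comment> \<open>Contractivity on the constants \<open>basis_vec [] \<otimes> h\<close>, in
      every degree, makes the coefficients square-summable and \<phi> a contraction.\<close>
    have le: "(\<Sum>\<beta>\<in>F. (norm (c \<beta> h))\<^sup>2) \<le> (norm h)\<^sup>2" if "finite F" for F h
    proof -
      have "(\<Sum>\<gamma>\<in>F. (norm (conv c (basis_vec [] \<otimes> h) \<gamma>))\<^sup>2) \<le> (norm (basis_vec [] \<otimes> h :: ('i, 'a) fock_tensor))\<^sup>2"
        using that by (intro contrD[OF cj[of "Max (length ` F)"]]) (auto simp: polys_def component_basis_tens)
      then show ?thesis by (simp add: conv_basis_tens[OF c] norm_basis_tens)
    qed
    have comp: "component (\<phi> h) \<beta> = c \<beta> h" for h \<beta>
      unfolding \<phi>_def by (rule component_Abs_ell2[OF le])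
    have "(norm (\<phi> h))\<^sup>2 \<le> (norm h)\<^sup>2" for h
      unfolding ell2_norm_sq_le_iff by (simp add: comp le)
    then have "bounded_clinear \<phi>"
      by (intro bounded_clinearI[where K = 1])
        (auto intro!: ell2_eqI simp: comp bounded_clinear_simps[OF c])
    moreover from this have "norm_on (polys k) (mult_op \<phi>) \<le> 1"
      using norm_on_mult_op_iff[of \<phi> k] by (simp add: comp cj)
    moreover have "\<forall>\<alpha>. length \<alpha> \<le> m \<longrightarrow> \<theta> \<alpha> = fcoeff \<phi> \<alpha>"
      by (simp add: fcoeff_eq comp cm c0_def fun_eq_iff)
    ultimately show ?lhs by blast
  qed
  finally show ?thesis by blast
qed

end
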